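(* There is an algorithm that, given a cograph $G$ (a finite simple graph with no induced path on four vertices) and a template $t\colon V(G)\to C$, computes an optimal paint plan that paints $t$ onto $G$ in time polynomial in the size of $G$ and $|C|$.
   Context: A vertex set $A\subseteq V(G)$ is connected if $G[A]$ is connected. A painting is a (possibly partial) function $p\colon V(G)\to C$; a template is a total painting. A brush stroke is a pair $(A,c)$ with $A\subseteq V(G)$ connected and $c\in C$; applying it to $p$ gives $p'$ with $p'(v)=c$ for $v\in A$ and $p'(v)=p(v)$ otherwise. A paint plan painting $t$ onto $G$ is a non-empty sequence of strokes $(A_1,c_1),\dots,(A_s,c_s)$ such that starting from the everywhere-undefined painting and applying the strokes in order yields exactly $t$. It is optimal if $s$ is minimum among all such plans. *)

theory Defs
  imports
    "Graph_Theory.Digraph_Component"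
    "HOL-Computational_Algebra.Polynomial"
begin

section \<open>Graphs\<close>

text \<open>
  A finite simple graph is a \<^locale>\<open>pair_graph\<close>: a finite, loop-free, symmetric digraph without
  parallel arcs. An undirected edge \<open>{u, v}\<close> is therefore the pair of arcs \<open>(u, v)\<close>, \<open>(v, u)\<close>.
\<close>

abbreviation adjacent :: "'a pair_pre_digraph \<Rightarrow> 'a \<Rightarrow> 'a \<Rightarrow> bool" where
  "adjacent G u v \<equiv> (u, v) \<in> parcs G"

definition induced_P4 :: "'a pair_pre_digraph \<Rightarrow> 'a \<Rightarrow> 'a \<Rightarrow> 'a \<Rightarrow> 'a \<Rightarrow> bool" where
  "induced_P4 G a b c d \<longleftrightarrow>
     {a, b, c, d} \<subseteq> pverts G \<and> distinct [a, b, c, d] \<and>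
     adjacent G a b \<and> adjacent G b c \<and> adjacent G c d \<and>
     \<not> adjacent G a c \<and> \<not> adjacent G a d \<and> \<not> adjacent G b d"

definition cograph :: "'a pair_pre_digraph \<Rightarrow> bool" where
  "cograph G \<longleftrightarrow> pair_graph G \<and> \<not> (\<exists>a b c d. induced_P4 G a b c d)"

definition graph_size :: "'a pair_pre_digraph \<Rightarrow> nat" where
  "graph_size G = card (pverts G) + card (parcs G) div 2"

text \<open>
  The connectedness predicate is the one for graphs, not the topological one; it excludes the null
  graph, so a connected vertex set is nonempty.
\<close>

definition connected_set :: "'a pair_pre_digraph \<Rightarrow> 'a set \<Rightarrow> bool" where
  "connected_set G A \<longleftrightarrow>
     A \<subseteq> pverts G \<and> Digraph_Component.connected (with_proj G \<restriction> A)"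


section \<open>Painting\<close>

type_synonym ('a, 'c) painting = "'a \<rightharpoonup> 'c"
type_synonym ('a, 'c) stroke = "'a set \<times> 'c"

definition is_painting :: "'a pair_pre_digraph \<Rightarrow> 'c set \<Rightarrow> ('a, 'c) painting \<Rightarrow> bool" where
  "is_painting G C p \<longleftrightarrow> dom p \<subseteq> pverts G \<and> ran p \<subseteq> C"

definition is_template :: "'a pair_pre_digraph \<Rightarrow> 'c set \<Rightarrow> ('a, 'c) painting \<Rightarrow> bool" where
  "is_template G C t \<longleftrightarrow> is_painting G C t \<and> dom t = pverts G"

definition is_stroke :: "'a pair_pre_digraph \<Rightarrow> 'c set \<Rightarrow> ('a, 'c) stroke \<Rightarrow> bool" where
  "is_stroke G C s \<longleftrightarrow> connected_set G (fst s) \<and> snd s \<in> C"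

definition apply_stroke :: "('a, 'c) stroke \<Rightarrow> ('a, 'c) painting \<Rightarrow> ('a, 'c) painting" where
  "apply_stroke s p = (\<lambda>v. if v \<in> fst s then Some (snd s) else p v)"

definition paint_plan ::
  "'a pair_pre_digraph \<Rightarrow> 'c set \<Rightarrow> ('a, 'c) painting \<Rightarrow> ('a, 'c) stroke list \<Rightarrow> bool" where
  "paint_plan G C t ss \<longleftrightarrow>
     ss \<noteq> [] \<and> (\<forall>s\<in>set ss. is_stroke G C s) \<and> fold apply_stroke ss Map.empty = t"

definition optimal_paint_plan ::
  "'a pair_pre_digraph \<Rightarrow> 'c set \<Rightarrow> ('a, 'c) painting \<Rightarrow> ('a, 'c) stroke list \<Rightarrow> bool" where
  "optimal_paint_plan G C t ss \<longleftrightarrow>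
     paint_plan G C t ss \<and> (\<forall>ss'. paint_plan G C t ss' \<longrightarrow> length ss \<le> length ss')"


section \<open>Algorithms and running time\<close>

text \<open>
  An algorithm is a program in a first-order functional language (pure first-order LISP) whose only
  data are binary trees, as in N. D. Jones, Computability and Complexity (MIT Press, 1997).
  A program is a finite list of function bodies, which may call one another recursively; running
  it means calling function number 0. Inside a body, variables are de Bruijn indices into the
  environment: the arguments of the call, preceded by the variables bound by enclosing \<open>Case\<close>
  branches (left subtree first).

  The last argument of the evaluation relation is the running time: one unit for each rule
  application. Every rule does work bounded by a constant depending only on the program
  (trees are handled by reference, never copied or compared), so that polynomial time here agrees
  with polynomial time on Turing machines for functions whose outputs have polynomial size.
\<close>

datatype tree = Tip | Bin tree tree

datatype expr =
    Var nat
  | ETip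
  | EBin expr expr
  | Case expr expr expr
  | Call nat "expr list"

type_synonym program = "expr list"

inductive evaluates :: "program \<Rightarrow> tree list \<Rightarrow> expr \<Rightarrow> tree \<Rightarrow> nat \<Rightarrow> bool"
  and evaluates_list :: "program \<Rightarrow> tree list \<Rightarrow> expr list \<Rightarrow> tree list \<Rightarrow> nat \<Rightarrow> bool"
  for P :: program
where
  Var: "i < length env \<Longrightarrow> evaluates P env (Var i) (env ! i) 1"
| ETip: "evaluates P env ETip Tip 1"
| EBin: "evaluates P env e1 u m \<Longrightarrow> evaluates P env e2 v n \<Longrightarrow>
    evaluates P env (EBin e1 e2) (Bin u v) (m + n + 1)"
| Case_Tip: "evaluates P env e Tip m \<Longrightarrow> evaluates P env e1 w n \<Longrightarrow>
    evaluates P env (Case e e1 e2) w (m + n + 1)"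
| Case_Bin: "evaluates P env e (Bin u v) m \<Longrightarrow> evaluates P (u # v # env) e2 w n \<Longrightarrow>
    evaluates P env (Case e e1 e2) w (m + n + 1)"
| Call: "evaluates_list P env es vs m \<Longrightarrow> f < length P \<Longrightarrow> evaluates P vs (P ! f) w n \<Longrightarrow>
    evaluates P env (Call f es) w (m + n + 1)"
| Nil: "evaluates_list P env [] [] 0"
| Cons: "evaluates P env e v m \<Longrightarrow> evaluates_list P env es vs n \<Longrightarrow>
    evaluates_list P env (e # es) (v # vs) (m + n)"

lemma evaluates_deterministic:
  "evaluates P env e v m \<Longrightarrow> evaluates P env e v' m' \<Longrightarrow> v' = v \<and> m' = m"
  "evaluates_list P env es vs n \<Longrightarrow> evaluates_list P env es vs' n' \<Longrightarrow> vs' = vs \<and> n' = n"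
proof (induction arbitrary: v' m' and vs' n' rule: evaluates_evaluates_list.inducts)
  case (Case_Tip env e m e1 w n e2)
  from Case_Tip.prems show ?case by cases (use Case_Tip.IH in \<open>blast+\<close>)
next
  case (Case_Bin env e u v m e2 w n e1)
  from Case_Bin.prems show ?case by cases (use Case_Bin.IH in \<open>blast+\<close>)
next
  case (Call env es vs m f w n)
  from Call.prems show ?case by cases (use Call.IH in \<open>blast+\<close>)
qed (erule evaluates.cases evaluates_list.cases; blast)+

definition computes :: "program \<Rightarrow> tree \<Rightarrow> tree \<Rightarrow> nat \<Rightarrow> bool" where
  "computes P x y n \<longleftrightarrow> P \<noteq> [] \<and> evaluates P [x] (P ! 0) y n"


section \<open>Representation of inputs and outputs\<close>

fun enc_list :: "('b \<Rightarrow> tree) \<Rightarrow> 'b list \<Rightarrow> tree" where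
  "enc_list enc [] = Tip"
| "enc_list enc (x # xs) = Bin (enc x) (enc_list enc xs)"

fun enc_bool :: "bool \<Rightarrow> tree" where
  "enc_bool False = Tip"
| "enc_bool True = Bin Tip Tip"

text \<open>
  Numbers (the colours, and the number of colours) are in unary. This is harmless because time is
  measured in the number of colours itself, not in its logarithm.
\<close>

fun enc_nat :: "nat \<Rightarrow> tree" where
  "enc_nat 0 = Tip"
| "enc_nat (Suc n) = Bin Tip (enc_nat n)"

text \<open>
  The following encodings are for a graph with vertices \<open>0, \<dots>, n - 1\<close> and for colours
  \<open>0, \<dots>, k - 1\<close>. A graph is its adjacency matrix, a template is the list of the colours of the
  vertices, and a stroke is the 0-1 vector of its vertex set together with its colour.
\<close>

definition enc_graph :: "nat pair_pre_digraph \<Rightarrow> tree" where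
  "enc_graph G = (let vs = [0..<card (pverts G)] in
     enc_list (enc_list enc_bool) (map (\<lambda>u. map (\<lambda>v. adjacent G u v) vs) vs))"

definition enc_template :: "nat pair_pre_digraph \<Rightarrow> (nat, nat) painting \<Rightarrow> tree" where
  "enc_template G t = enc_list enc_nat (map (\<lambda>v. the (t v)) [0..<card (pverts G)])"

definition enc_input :: "nat pair_pre_digraph \<Rightarrow> nat \<Rightarrow> (nat, nat) painting \<Rightarrow> tree" where
  "enc_input G k t = Bin (enc_graph G) (Bin (enc_nat k) (enc_template G t))"

definition enc_stroke :: "nat pair_pre_digraph \<Rightarrow> (nat, nat) stroke \<Rightarrow> tree" where
  "enc_stroke G s =
     Bin (enc_list enc_bool (map (\<lambda>v. v \<in> fst s) [0..<card (pverts G)])) (enc_nat (snd s))"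

definition enc_plan :: "nat pair_pre_digraph \<Rightarrow> (nat, nat) stroke list \<Rightarrow> tree" where
  "enc_plan G ss = enc_list (enc_stroke G) ss"

lemma enc_plan_inj:
  assumes "pverts G = {..<n}"
    and "\<forall>s\<in>set ss. fst s \<subseteq> pverts G" and "\<forall>s\<in>set ss'. fst s \<subseteq> pverts G"
    and "enc_plan G ss = enc_plan G ss'"
  shows "ss = ss'"
proof -
  have nat_inj: "enc_nat a = enc_nat b \<Longrightarrow> a = b" for a b
  proof (induction a arbitrary: b)
    case 0 then show ?case by (cases b) auto
  next
    case (Suc a) then show ?case by (cases b) auto
  qed
  have list_inj: "xs = ys"
    if "enc_list enc xs = enc_list enc ys"
      "\<And>x y. x \<in> set xs \<Longrightarrow> y \<in> set ys \<Longrightarrow> enc x = enc y \<Longrightarrow> x = y"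
    for enc :: "'b \<Rightarrow> tree" and xs ys
    using that
  proof (induction xs arbitrary: ys)
    case Nil then show ?case by (cases ys) auto
  next
    case (Cons x xs)
    then obtain y ys' where ys: "ys = y # ys'" by (cases ys) simp_all
    have "x = y" using Cons.prems(1) ys by (intro Cons.prems(2)) simp_all
    moreover have "xs = ys'"
      using Cons.prems(1) ys by (intro Cons.IH Cons.prems(2)) simp_all
    ultimately show ?case using ys by simp
  qed
  have bool_inj: "enc_bool a = enc_bool b \<Longrightarrow> a = b" for a b
    by (cases a; cases b) auto
  have "s = s'" if "s \<in> set ss" "s' \<in> set ss'" "enc_stroke G s = enc_stroke G s'" for s s'
  proof -
    have enc: "enc_list enc_bool (map (\<lambda>v. v \<in> fst s) [0..<n]) =
        enc_list enc_bool (map (\<lambda>v. v \<in> fst s') [0..<n])"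
      and "enc_nat (snd s) = enc_nat (snd s')"
      using that(3) assms(1) by (simp_all add: enc_stroke_def)
    from this(2) have "snd s = snd s'" by (rule nat_inj)
    from enc have "map (\<lambda>v. v \<in> fst s) [0..<n] = map (\<lambda>v. v \<in> fst s') [0..<n]"
      by (rule list_inj) (rule bool_inj)
    then have "\<forall>v<n. v \<in> fst s \<longleftrightarrow> v \<in> fst s'" by auto
    moreover have "fst s \<subseteq> {..<n}" "fst s' \<subseteq> {..<n}" using that assms by auto
    ultimately have "fst s = fst s'" by blast
    with \<open>snd s = snd s'\<close> show ?thesis by (simp add: prod_eq_iff)
  qed
  with assms(4) show ?thesis unfolding enc_plan_def by (rule list_inj)
qed

end

theory Submission
  imports Defs
begin

text \<open>
  In a graph without induced \<open>P\<^sub>4\<close>, vertices of a connected set are at distance at most two inside the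
  set, and every vertex \<open>a\<close> of a component has a neighbour \<open>b\<close> (one with the most neighbours outside
  the neighbourhood of \<open>a\<close>) such that \<open>{a, b}\<close> dominates the component. Adding \<open>{a, b}\<close> to a colour
  class thus makes it connected, so one stroke per colour, followed by repairs of \<open>b\<close> and \<open>a\<close>, paints
  the component; if the class of \<open>a\<close> is connected, it serves as the last stroke and every colour is
  used once, otherwise one additional stroke suffices. Conversely the last stroke that touches a
  component lies in one colour class, and if every colour is used only once it is the whole class;
  so the additional stroke is needed when no class is connected.

  Since distances are at most two, components, connectivity of colour classes and the choice of
  \<open>a\<close> and \<open>b\<close> are all first-order definable. One interpreter for first-order formulas with loops over
  the vertices therefore computes the plan, in time polynomial for each fixed formula.
\<close>


section \<open>Running programs\<close>

text \<open>
  The evaluation relation as a partial function, whose recursion equations let the simplifier run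
  programs.
\<close>

definition result :: "program \<Rightarrow> tree list \<Rightarrow> expr \<Rightarrow> (tree \<times> nat) option" where
  "result P env e = (if \<exists>r. evaluates P env e (fst r) (snd r)
     then Some (SOME r. evaluates P env e (fst r) (snd r)) else None)"

text \<open>By \<open>evaluates_deterministic\<close> a run has at most one value and one cost, so
  the choice made in \<open>result\<close> is forced.\<close>

lemma result_eq_Some_iff: "result P env e = Some (v, m) \<longleftrightarrow> evaluates P env e v m"
proof
  assume "result P env e = Some (v, m)"
  then have ex: "\<exists>r. evaluates P env e (fst r) (snd r)"
    and eq: "(SOME r. evaluates P env e (fst r) (snd r)) = (v, m)"
    by (auto simp: result_def split: if_splits)
  show "evaluates P env e v m" using someI_ex[OF ex] eq by simp
next
  assume ev: "evaluates P env e v m"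
  then have ex: "\<exists>r. evaluates P env e (fst r) (snd r)" by (intro exI[of _ "(v, m)"]) simp
  have "(SOME r. evaluates P env e (fst r) (snd r)) = (v, m)"
    using someI_ex[OF ex] evaluates_deterministic(1)[OF ev] by (metis prod.collapse)
  with ex show "result P env e = Some (v, m)" by (simp add: result_def)
qed

fun results :: "program \<Rightarrow> tree list \<Rightarrow> expr list \<Rightarrow> (tree list \<times> nat) option" where
  "results P env [] = Some ([], 0)"
| "results P env (e # es) = (case result P env e of None \<Rightarrow> None | Some (v, m) \<Rightarrow>
     (case results P env es of None \<Rightarrow> None | Some (vs, n) \<Rightarrow> Some (v # vs, m + n)))"

lemma results_eq_Some_iff: "results P env es = Some (vs, n) \<longleftrightarrow> evaluates_list P env es vs n"
proof (induction es arbitrary: vs n)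
  case Nil
  show ?case by (auto intro: evaluates_evaluates_list.Nil elim: evaluates_list.cases)
next
  case (Cons e es)
  have "evaluates_list P env (e # es) vs n \<longleftrightarrow> (\<exists>v m ws k. evaluates P env e v m \<and>
      evaluates_list P env es ws k \<and> vs = v # ws \<and> n = m + k)"
    by (subst evaluates_list.simps) (simp; blast)
  then show ?case
    by (auto simp flip: Cons.IH result_eq_Some_iff split: option.splits)
qed

lemma option_eqI: "(\<And>a b. x = Some (a, b) \<longleftrightarrow> y = Some (a, b)) \<Longrightarrow> x = y"
  by (cases x; cases y) (metis option.distinct(1) option.inject surj_pair)+

lemma result_simps [simp]:
  "result P env (Var i) = (if i < length env then Some (env ! i, 1) else None)"
  "result P env ETip = Some (Tip, 1)"
  "result P env (EBin e1 e2) = (case result P env e1 of None \<Rightarrow> None | Some (u, m) \<Rightarrow>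
     (case result P env e2 of None \<Rightarrow> None | Some (v, n) \<Rightarrow> Some (Bin u v, m + n + 1)))"
  "result P env (Case e e1 e2) = (case result P env e of None \<Rightarrow> None | Some (w, m) \<Rightarrow>
     (case (case w of Tip \<Rightarrow> result P env e1 | Bin u v \<Rightarrow> result P (u # v # env) e2) of
        None \<Rightarrow> None | Some (v, n) \<Rightarrow> Some (v, m + n + 1)))"
  "result P env (Call f es) = (case results P env es of None \<Rightarrow> None | Some (vs, m) \<Rightarrow>
     (if f < length P then (case result P vs (P ! f) of None \<Rightarrow> None
        | Some (v, n) \<Rightarrow> Some (v, m + n + 1)) else None))"
proof -
  have *: "evaluates P env (Var i) a b \<longleftrightarrow> i < length env \<and> a = env ! i \<and> b = 1" for a b
    by (subst evaluates.simps) auto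
  show "result P env (Var i) = (if i < length env then Some (env ! i, 1) else None)"
    by (rule option_eqI) (auto simp: result_eq_Some_iff *)
  have *: "evaluates P env ETip a b \<longleftrightarrow> a = Tip \<and> b = 1" for a b
    by (subst evaluates.simps) auto
  show "result P env ETip = Some (Tip, 1)"
    by (rule option_eqI) (auto simp: result_eq_Some_iff *)
  have *: "evaluates P env (EBin e1 e2) a b \<longleftrightarrow> (\<exists>u m v n. evaluates P env e1 u m \<and>
      evaluates P env e2 v n \<and> a = Bin u v \<and> b = m + n + 1)" for a b
    by (subst evaluates.simps) auto
  show "result P env (EBin e1 e2) = (case result P env e1 of None \<Rightarrow> None | Some (u, m) \<Rightarrow>
     (case result P env e2 of None \<Rightarrow> None | Some (v, n) \<Rightarrow> Some (Bin u v, m + n + 1)))"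
    by (rule option_eqI, simp only: result_eq_Some_iff *)
       (auto simp flip: result_eq_Some_iff split: option.splits)
  have *: "evaluates P env (Case e e1 e2) a b \<longleftrightarrow>
      (\<exists>m n. evaluates P env e Tip m \<and> evaluates P env e1 a n \<and> b = m + n + 1) \<or>
      (\<exists>u v m n. evaluates P env e (Bin u v) m \<and> evaluates P (u # v # env) e2 a n \<and>
         b = m + n + 1)" for a b
    by (subst evaluates.simps) (simp; blast)
  show "result P env (Case e e1 e2) = (case result P env e of None \<Rightarrow> None | Some (w, m) \<Rightarrow>
     (case (case w of Tip \<Rightarrow> result P env e1 | Bin u v \<Rightarrow> result P (u # v # env) e2) of
        None \<Rightarrow> None | Some (v, n) \<Rightarrow> Some (v, m + n + 1)))"
    by (rule option_eqI, simp only: result_eq_Some_iff *)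
       (auto simp flip: result_eq_Some_iff split: option.splits tree.splits)
  have *: "evaluates P env (Call f es) a b \<longleftrightarrow> (\<exists>vs m n. evaluates_list P env es vs m \<and>
      f < length P \<and> evaluates P vs (P ! f) a n \<and> b = m + n + 1)" for a b
    by (subst evaluates.simps) auto
  show "result P env (Call f es) = (case results P env es of None \<Rightarrow> None | Some (vs, m) \<Rightarrow>
     (if f < length P then (case result P vs (P ! f) of None \<Rightarrow> None
        | Some (v, n) \<Rightarrow> Some (v, m + n + 1)) else None))"
    by (rule option_eqI, simp only: result_eq_Some_iff *)
       (auto simp flip: result_eq_Some_iff results_eq_Some_iff split: option.splits)
qed

fun quote :: "tree \<Rightarrow> expr" where
  "quote Tip = ETip"
| "quote (Bin u v) = EBin (quote u) (quote v)"

text \<open>The cost is chosen before \<open>P\<close> and \<open>env\<close>: building the syntax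
  tree of a fixed command takes constant time.\<close>

lemma result_quote: "\<exists>m. \<forall>P env. result P env (quote t) = Some (t, m)"
proof (induction t)
  case (Bin u v)
  then obtain m n where "\<forall>P env. result P env (quote u) = Some (u, m)"
    "\<forall>P env. result P env (quote v) = Some (v, n)" by blast
  then show ?case by simp
qed simp


section \<open>An interpreter for first-order formulas\<close>

text \<open>Variables are de Bruijn indices.\<close>

datatype form = Adj nat nat | Le nat nat | Col_Le nat nat | Nand form form | Exists form

text \<open>All iteration runs over the vertices: in \<open>For\<close>, in \<open>Exists\<close>,
  and in the vertex vector built by \<open>Emit\<close>. A fixed command therefore takes polynomial
  time, with a degree governed by its nesting depth.\<close>

datatype cmd = When form cmd | For cmd | Seq cmd cmd | Emit form nat

text \<open>Each node is a unary tag next to a pair of arguments (\<open>Exists\<close> is padded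
  with \<open>Tip\<close>). The interpreter can thus take any node apart in the same way and then
  peel off the tag.\<close>

fun enc_form :: "form \<Rightarrow> tree" where
  "enc_form (Adj i j) = Bin Tip (Bin (enc_nat i) (enc_nat j))"
| "enc_form (Le i j) = Bin (enc_nat (Suc 0)) (Bin (enc_nat i) (enc_nat j))"
| "enc_form (Col_Le i j) = Bin (enc_nat (Suc (Suc 0))) (Bin (enc_nat i) (enc_nat j))"
| "enc_form (Nand \<phi> \<psi>) = Bin (enc_nat (Suc (Suc (Suc 0)))) (Bin (enc_form \<phi>) (enc_form \<psi>))"
| "enc_form (Exists \<phi>) = Bin (enc_nat (Suc (Suc (Suc (Suc 0))))) (Bin (enc_form \<phi>) Tip)"

fun enc_cmd :: "cmd \<Rightarrow> tree" where
  "enc_cmd (When \<phi> c) = Bin Tip (Bin (enc_form \<phi>) (enc_cmd c))"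
| "enc_cmd (For c) = Bin (enc_nat (Suc 0)) (Bin (enc_cmd c) Tip)"
| "enc_cmd (Seq c d) = Bin (enc_nat (Suc (Suc 0))) (Bin (enc_cmd c) (enc_cmd d))"
| "enc_cmd (Emit \<phi> i) = Bin (enc_nat (Suc (Suc (Suc 0)))) (Bin (enc_form \<phi>) (enc_nat i))"

text \<open>
  The interpreter consists of the functions 0 (main), 1 (list lookup), 2 (comparison), 3 (truth of a
  formula), 4 (existential quantifier), 5 (vertex set of a stroke), 6 (command) and 7 (loop). The
  arguments of 3 to 7 are the syntax tree (for the loops 4, 5 and 7 preceded by the vertices still
  to be visited), the environment, the adjacency matrix, the colour list and, for 5 to 7, an
  accumulator. Loops run downwards, so the accumulated lists come out in increasing order.
\<close>

abbreviation ETrue :: expr where "ETrue \<equiv> EBin ETip ETip"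

definition main_body :: "cmd \<Rightarrow> expr" where
  "main_body c = Case (Var 0) ETip (Case (Var 1) ETip
     (Call 6 [quote (enc_cmd c), ETip, Var 2, Var 1, ETip]))"

definition get_body :: expr where
  "get_body = Case (Var 0) ETip (Case (Var 3) (Var 0) (Call 1 [Var 3, Var 1]))"

definition le_body :: expr where
  "le_body = Case (Var 0) ETrue (Case (Var 3) ETip (Call 2 [Var 3, Var 1]))"

text \<open>Every \<open>Case\<close> on a \<open>Bin\<close> pushes two variables, so all indices
  grow by two with each tag tested. The branches are \<open>Adj\<close>, \<open>Le\<close>,
  \<open>Col_Le\<close>, \<open>Nand\<close> and \<open>Exists\<close>, in this order.\<close>

definition sat_body :: expr where
  "sat_body = Case (Var 0) ETip (Case (Var 1) ETip
     (Case (Var 2)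
       (Call 1 [Call 1 [Var 6, Call 1 [Var 5, Var 0]], Call 1 [Var 5, Var 1]])
     (Case (Var 1)
       (Call 2 [Call 1 [Var 7, Var 2], Call 1 [Var 7, Var 3]])
     (Case (Var 1)
       (Call 2 [Call 1 [Var 11, Call 1 [Var 9, Var 4]], Call 1 [Var 11, Call 1 [Var 9, Var 5]]])
     (Case (Var 1)
       (Case (Call 3 [Var 6, Var 11, Var 12, Var 13]) ETrue
         (Case (Call 3 [Var 9, Var 13, Var 14, Var 15]) ETrue ETip))
       (Call 4 [Var 15, Var 8, Var 13, Var 14, Var 15]))))))"

text \<open>The tail \<open>Var 1\<close> plays two roles: it is the vertex pushed onto the
  environment in this round, and the list of vertices still to be visited.\<close>

definition ex_body :: expr where
  "ex_body = Case (Var 0) ETip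
     (Case (Call 3 [Var 3, EBin (Var 1) (Var 4), Var 5, Var 6])
       (Call 4 [Var 1, Var 3, Var 4, Var 5, Var 6]) ETrue)"

definition vec_body :: expr where
  "vec_body = Case (Var 0) (Var 5)
     (Call 5 [Var 1, Var 3, Var 4, Var 5, Var 6,
        EBin (Call 3 [Var 3, EBin (Var 1) (Var 4), Var 5, Var 6]) (Var 7)])"

text \<open>Strokes are put in front of the accumulator, so \<open>Seq\<close> lets its second
  command fill the accumulator before the first one runs.\<close>

definition run_body :: expr where
  "run_body = Case (Var 0) ETip (Case (Var 1) ETip
     (Case (Var 2)
       (Case (Call 3 [Var 0, Var 5, Var 6, Var 7]) (Var 8)
         (Call 6 [Var 3, Var 7, Var 8, Var 9, Var 10]))
     (Case (Var 1)
       (Call 7 [Var 9, Var 2, Var 7, Var 8, Var 9, Var 10])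
     (Case (Var 1)
       (Call 6 [Var 4, Var 9, Var 10, Var 11, Call 6 [Var 5, Var 9, Var 10, Var 11, Var 12]])
       (EBin (EBin (Call 5 [Var 13, Var 6, Var 11, Var 12, Var 13, ETip])
            (Call 1 [Var 13, Call 1 [Var 11, Var 7]]))
          (Var 14))))))"

definition for_body :: expr where
  "for_body = Case (Var 0) (Var 5)
     (Call 7 [Var 1, Var 3, Var 4, Var 5, Var 6,
        Call 6 [Var 3, EBin (Var 1) (Var 4), Var 5, Var 6, Var 7]])"

definition interpreter :: "cmd \<Rightarrow> program" where
  "interpreter c = [main_body c, get_body, le_body, sat_body, ex_body, vec_body, run_body, for_body]"

lemma length_interpreter [simp]: "length (interpreter c) = 8"
  by (simp add: interpreter_def)

definition call :: "cmd \<Rightarrow> nat \<Rightarrow> tree list \<Rightarrow> (tree \<times> nat) option" where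
  "call c f vs = result (interpreter c) vs (interpreter c ! f)"

text \<open>Folding called bodies into \<open>call\<close> makes the simplifier execute one body at
  a time and stop at recursive calls, where the induction hypotheses apply.\<close>

lemma result_call [simp]: "result (interpreter c) vs (interpreter c ! f) = call c f vs"
  by (simp add: call_def)

lemma call_body:
  "call c 0 vs = result (interpreter c) vs (main_body c)"
  "call c (Suc 0) vs = result (interpreter c) vs get_body"
  "call c 2 vs = result (interpreter c) vs le_body"
  "call c 3 vs = result (interpreter c) vs sat_body"
  "call c 4 vs = result (interpreter c) vs ex_body"
  "call c 5 vs = result (interpreter c) vs vec_body"
  "call c 6 vs = result (interpreter c) vs run_body"
  "call c 7 vs = result (interpreter c) vs for_body"
  by (simp_all add: call_def interpreter_def)

text \<open>Lists and unary numbers are both indexed by the length of the right spine.\<close>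

fun spine :: "tree \<Rightarrow> nat" where
  "spine Tip = 0"
| "spine (Bin u v) = Suc (spine v)"

lemma spine_enc_nat [simp]: "spine (enc_nat i) = i"
  by (induction i) simp_all

text \<open>Only the spine of the index matters, so a vertex stored as a suffix of the colour list
  can index the matrix directly.\<close>

lemma call_get:
  "spine i < length xs \<Longrightarrow>
     \<exists>m \<le> 8 * (spine i + 1). call c (Suc 0) [enc_list f xs, i] = Some (f (xs ! spine i), m)"
proof (induction xs arbitrary: i)
  case (Cons x xs)
  show ?case
  proof (cases i)
    case Tip
    then show ?thesis by (subst call_body) (simp add: get_body_def)
  next
    case (Bin u j)
    then obtain m where "m \<le> 8 * (spine j + 1)"
      "call c (Suc 0) [enc_list f xs, j] = Some (f (xs ! spine j), m)"
      using Cons by force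
    then show ?thesis using Bin by (subst call_body) (simp add: get_body_def)
  qed
qed simp

lemma call_le:
  "\<exists>m \<le> 8 * (spine x + 1). call c 2 [x, y] = Some (enc_bool (spine x \<le> spine y), m)"
proof (induction x arbitrary: y)
  case Tip
  then show ?case by (subst call_body) (simp add: le_body_def)
next
  case (Bin u x)
  show ?case
  proof (cases y)
    case Tip
    then show ?thesis by (subst call_body) (simp add: le_body_def)
  next
    case y: (Bin w z)
    obtain m where "m \<le> 8 * (spine x + 1)"
      "call c 2 [x, z] = Some (enc_bool (spine x \<le> spine z), m)"
      using Bin.IH(2) by blast
    then show ?thesis using y by (subst call_body) (simp add: le_body_def)
  qed
qed

section \<open>Semantics of formulas and commands\<close>

locale coloured_graph =
  fixes n :: nat and adj :: "nat \<Rightarrow> nat \<Rightarrow> bool" and col :: "nat \<Rightarrow> nat" and N :: nat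
  assumes n_le: "n \<le> N" and col_le: "v < n \<Longrightarrow> col v \<le> N"
begin

fun sat :: "nat list \<Rightarrow> form \<Rightarrow> bool" where
  "sat e (Adj i j) \<longleftrightarrow> adj (e ! i) (e ! j)"
| "sat e (Le i j) \<longleftrightarrow> e ! i \<le> e ! j"
| "sat e (Col_Le i j) \<longleftrightarrow> col (e ! i) \<le> col (e ! j)"
| "sat e (Nand \<phi> \<psi>) \<longleftrightarrow> \<not> (sat e \<phi> \<and> sat e \<psi>)"
| "sat e (Exists \<phi>) \<longleftrightarrow> (\<exists>v<n. sat (v # e) \<phi>)"

fun emitted :: "nat list \<Rightarrow> cmd \<Rightarrow> (nat, nat) stroke list" where
  "emitted e (When \<phi> c) = (if sat e \<phi> then emitted e c else [])"
| "emitted e (For c) = concat (map (\<lambda>v. emitted (v # e) c) [0..<n])"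
| "emitted e (Seq c d) = emitted e c @ emitted e d"
| "emitted e (Emit \<phi> i) = [({v. v < n \<and> sat (v # e) \<phi>}, col (e ! i))]"

end

fun wf_form :: "nat \<Rightarrow> form \<Rightarrow> bool" where
  "wf_form k (Adj i j) \<longleftrightarrow> i < k \<and> j < k"
| "wf_form k (Le i j) \<longleftrightarrow> i < k \<and> j < k"
| "wf_form k (Col_Le i j) \<longleftrightarrow> i < k \<and> j < k"
| "wf_form k (Nand \<phi> \<psi>) \<longleftrightarrow> wf_form k \<phi> \<and> wf_form k \<psi>"
| "wf_form k (Exists \<phi>) \<longleftrightarrow> wf_form (Suc k) \<phi>"

fun wf_cmd :: "nat \<Rightarrow> cmd \<Rightarrow> bool" where
  "wf_cmd k (When \<phi> c) \<longleftrightarrow> wf_form k \<phi> \<and> wf_cmd k c"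
| "wf_cmd k (For c) \<longleftrightarrow> wf_cmd (Suc k) c"
| "wf_cmd k (Seq c d) \<longleftrightarrow> wf_cmd k c \<and> wf_cmd k d"
| "wf_cmd k (Emit \<phi> i) \<longleftrightarrow> wf_form (Suc k) \<phi> \<and> i < k"

text \<open>Polynomials in \<open>N\<close>, which bounds the number of vertices and the unary
  colours alike. A quantifier takes at most \<open>N + 1\<close> rounds, the last one on the empty
  suffix; 100 absorbs the steps of one function body.\<close>

fun form_time :: "form \<Rightarrow> nat poly" where
  "form_time (Adj i j) = [:100 + 8 * i + 8 * j, 16:]"
| "form_time (Le i j) = [:100 + 8 * i + 8 * j, 8:]"
| "form_time (Col_Le i j) = [:100 + 8 * i + 8 * j, 24:]"
| "form_time (Nand \<phi> \<psi>) = form_time \<phi> + form_time \<psi> + [:100:]"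
| "form_time (Exists \<phi>) = [:1, 1:] * (form_time \<phi> + [:100:]) + [:100:]"

fun cmd_time :: "cmd \<Rightarrow> nat poly" where
  "cmd_time (When \<phi> c) = form_time \<phi> + cmd_time c + [:100:]"
| "cmd_time (For c) = [:1, 1:] * (cmd_time c + [:100:]) + [:100:]"
| "cmd_time (Seq c d) = cmd_time c + cmd_time d + [:100:]"
| "cmd_time (Emit \<phi> i) = [:1, 1:] * (form_time \<phi> + [:100:]) + [:200 + 8 * i, 8:]"

section \<open>Tree representation and the cost of evaluating formulas\<close>

context coloured_graph
begin

definition matrix :: tree where
  "matrix = enc_list (enc_list enc_bool) (map (\<lambda>u. map (adj u) [0..<n]) [0..<n])"

definition colours :: tree where
  "colours = enc_list enc_nat (map col [0..<n])"

text \<open>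
  A value of a variable is represented by a suffix of the colour list: the vertex \<open>i\<close> is the suffix
  of length \<open>i\<close>, so a loop over the vertices is just a recursion on the colour list.
\<close>

definition vertex :: "nat \<Rightarrow> tree" where
  "vertex i = enc_list enc_nat (map col [n - i..<n])"

definition env_tree :: "nat list \<Rightarrow> tree" where
  "env_tree e = enc_list vertex e"

text \<open>This is \<open>enc_stroke\<close> for any graph with \<open>n\<close> vertices, phrased
  without mentioning the graph.\<close>

definition enc_vertex_set_stroke :: "(nat, nat) stroke \<Rightarrow> tree" where
  "enc_vertex_set_stroke s =
     Bin (enc_list enc_bool (map (\<lambda>v. v \<in> fst s) [0..<n])) (enc_nat (snd s))"

lemma vertex_n: "vertex n = colours"
  by (simp add: vertex_def colours_def)

lemma vertex_0 [simp]: "vertex 0 = Tip"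
  by (simp add: vertex_def)

lemma vertex_Suc: "i < n \<Longrightarrow> vertex (Suc i) = Bin (enc_nat (col (n - Suc i))) (vertex i)"
  by (simp add: vertex_def upt_conv_Cons Suc_diff_Suc)

lemma spine_vertex: "i \<le> n \<Longrightarrow> spine (vertex i) = i"
  by (induction i) (simp_all add: vertex_Suc)

lemma env_tree_Cons: "env_tree (v # e) = Bin (vertex v) (env_tree e)"
  by (simp add: env_tree_def)

lemma call_get_env:
  "i < length e \<Longrightarrow>
     \<exists>m \<le> 8 * (i + 1). call c (Suc 0) [env_tree e, enc_nat i] = Some (vertex (e ! i), m)"
  using call_get[of "enc_nat i" e c vertex] by (simp add: env_tree_def)

lemma call_get_colours:
  "v < n \<Longrightarrow> \<exists>m \<le> 8 * (N + 1). call c (Suc 0) [colours, vertex v] = Some (enc_nat (col v), m)"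
  using call_get[of "vertex v" "map col [0..<n]" c enc_nat] n_le
  by (simp add: colours_def spine_vertex)
     (meson Suc_le_mono add_le_mono le_trans less_imp_le mult_le_mono2 order_refl)

lemma call_get_matrix:
  "u < n \<Longrightarrow> \<exists>m \<le> 8 * (N + 1). call c (Suc 0) [matrix, vertex u] =
     Some (enc_list enc_bool (map (adj u) [0..<n]), m)"
  using call_get[of "vertex u" "map (\<lambda>u. map (adj u) [0..<n]) [0..<n]" c "enc_list enc_bool"] n_le
  by (simp add: matrix_def spine_vertex)
     (meson Suc_le_mono add_le_mono le_trans less_imp_le mult_le_mono2 order_refl)

lemma call_get_row:
  "v < n \<Longrightarrow> \<exists>m \<le> 8 * (N + 1). call c (Suc 0) [enc_list enc_bool (map (adj u) [0..<n]), vertex v] =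
     Some (enc_bool (adj u v), m)"
  using call_get[of "vertex v" "map (adj u) [0..<n]" c enc_bool] n_le
  by (simp add: spine_vertex)
     (meson Suc_le_mono add_le_mono le_trans less_imp_le mult_le_mono2 order_refl)

text \<open>The assumption \<open>body\<close> stands for the induction hypothesis of
  \<open>call_sat\<close>. This separates the loop over the vertices, an induction on
  \<open>i\<close>, from the induction on formulas.\<close>

lemma call_ex:
  assumes body: "\<And>v. v < n \<Longrightarrow> \<exists>m \<le> B. call c 3 [enc_form \<phi>, env_tree (v # e), matrix, colours] =
      Some (enc_bool (sat (v # e) \<phi>), m)"
  shows "i \<le> n \<Longrightarrow> \<exists>m \<le> (i + 1) * (B + 100).
    call c 4 [vertex i, enc_form \<phi>, env_tree e, matrix, colours] =
      Some (enc_bool (\<exists>v<i. sat (v # e) \<phi>), m)"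
proof (induction i)
  case 0
  then show ?case by (subst call_body) (simp add: ex_body_def)
next
  case (Suc i)
  then obtain k where k: "k \<le> (i + 1) * (B + 100)"
    "call c 4 [vertex i, enc_form \<phi>, env_tree e, matrix, colours] =
      Some (enc_bool (\<exists>v<i. sat (v # e) \<phi>), k)" by auto
  obtain m where m: "m \<le> B" "call c 3 [enc_form \<phi>, env_tree (i # e), matrix, colours] =
      Some (enc_bool (sat (i # e) \<phi>), m)" using body[of i] Suc.prems by auto
  show ?case
  proof (cases "sat (i # e) \<phi>")
    case True
    then have "\<exists>v<Suc i. sat (v # e) \<phi>" by blast
    with True show ?thesis using m Suc.prems
      by (subst call_body) (simp add: ex_body_def vertex_Suc env_tree_Cons algebra_simps)
  next
    case False
    then have "(\<exists>v<Suc i. sat (v # e) \<phi>) \<longleftrightarrow> (\<exists>v<i. sat (v # e) \<phi>)"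
      using less_Suc_eq by auto
    with False show ?thesis using m k Suc.prems
      by (subst call_body) (simp add: ex_body_def vertex_Suc env_tree_Cons algebra_simps)
  qed
qed

lemma call_sat:
  "wf_form (length e) \<phi> \<Longrightarrow> \<forall>v\<in>set e. v < n \<Longrightarrow>
     \<exists>m \<le> poly (form_time \<phi>) N.
       call c 3 [enc_form \<phi>, env_tree e, matrix, colours] = Some (enc_bool (sat e \<phi>), m)"
proof (induction \<phi> arbitrary: e)
  case (Adj i j)
  then have lt: "e ! i < n" "e ! j < n" by auto
  obtain m1 where 1: "m1 \<le> 8 * (i + 1)"
    "call c (Suc 0) [env_tree e, enc_nat i] = Some (vertex (e ! i), m1)"
    using call_get_env Adj.prems by (meson wf_form.simps)
  obtain m2 where 2: "m2 \<le> 8 * (j + 1)"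
    "call c (Suc 0) [env_tree e, enc_nat j] = Some (vertex (e ! j), m2)"
    using call_get_env Adj.prems by (meson wf_form.simps)
  obtain m3 where 3: "m3 \<le> 8 * (N + 1)" "call c (Suc 0) [matrix, vertex (e ! i)] =
     Some (enc_list enc_bool (map (adj (e ! i)) [0..<n]), m3)"
    using call_get_matrix[OF lt(1)] by blast
  obtain m4 where 4: "m4 \<le> 8 * (N + 1)"
    "call c (Suc 0) [enc_list enc_bool (map (adj (e ! i)) [0..<n]), vertex (e ! j)] =
     Some (enc_bool (adj (e ! i) (e ! j)), m4)"
    using call_get_row[OF lt(2)] by blast
  from 1 2 3 4 show ?case
    by (subst call_body) (simp add: sat_body_def del: enc_list.simps)
next
  case (Le i j)
  then have lt: "e ! i < n" "e ! j < n" by auto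
  obtain m1 where 1: "m1 \<le> 8 * (i + 1)"
    "call c (Suc 0) [env_tree e, enc_nat i] = Some (vertex (e ! i), m1)"
    using call_get_env Le.prems by (meson wf_form.simps)
  obtain m2 where 2: "m2 \<le> 8 * (j + 1)"
    "call c (Suc 0) [env_tree e, enc_nat j] = Some (vertex (e ! j), m2)"
    using call_get_env Le.prems by (meson wf_form.simps)
  obtain m3 where 3: "m3 \<le> 8 * (e ! i + 1)" "call c 2 [vertex (e ! i), vertex (e ! j)] =
     Some (enc_bool (e ! i \<le> e ! j), m3)"
    using call_le[of "vertex (e ! i)" c "vertex (e ! j)"] lt by (auto simp: spine_vertex)
  from 1 2 3 lt n_le show ?case
    by (subst call_body) (simp add: sat_body_def)
next
  case (Col_Le i j)
  then have lt: "e ! i < n" "e ! j < n" by auto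
  obtain m1 where 1: "m1 \<le> 8 * (i + 1)"
    "call c (Suc 0) [env_tree e, enc_nat i] = Some (vertex (e ! i), m1)"
    using call_get_env Col_Le.prems by (meson wf_form.simps)
  obtain m2 where 2: "m2 \<le> 8 * (j + 1)"
    "call c (Suc 0) [env_tree e, enc_nat j] = Some (vertex (e ! j), m2)"
    using call_get_env Col_Le.prems by (meson wf_form.simps)
  obtain m3 where 3: "m3 \<le> 8 * (N + 1)"
    "call c (Suc 0) [colours, vertex (e ! i)] = Some (enc_nat (col (e ! i)), m3)"
    using call_get_colours[OF lt(1)] by blast
  obtain m4 where 4: "m4 \<le> 8 * (N + 1)"
    "call c (Suc 0) [colours, vertex (e ! j)] = Some (enc_nat (col (e ! j)), m4)"
    using call_get_colours[OF lt(2)] by blast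
  obtain m5 where 5: "m5 \<le> 8 * (col (e ! i) + 1)"
    "call c 2 [enc_nat (col (e ! i)), enc_nat (col (e ! j))] =
     Some (enc_bool (col (e ! i) \<le> col (e ! j)), m5)"
    using call_le[of "enc_nat (col (e ! i))" c "enc_nat (col (e ! j))"] by auto
  from 1 2 3 4 5 col_le[OF lt(1)] show ?case
    by (subst call_body) (simp add: sat_body_def)
next
  case (Nand \<phi> \<psi>)
  obtain m1 where 1: "m1 \<le> poly (form_time \<phi>) N"
    "call c 3 [enc_form \<phi>, env_tree e, matrix, colours] = Some (enc_bool (sat e \<phi>), m1)"
    using Nand.IH(1)[of e] Nand.prems by auto
  obtain m2 where 2: "m2 \<le> poly (form_time \<psi>) N"
    "call c 3 [enc_form \<psi>, env_tree e, matrix, colours] = Some (enc_bool (sat e \<psi>), m2)"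
    using Nand.IH(2)[of e] Nand.prems by auto
  from 1 2 show ?case
    by (subst call_body)
       (cases "sat e \<phi>"; cases "sat e \<psi>"; simp add: sat_body_def)
next
  case (Exists \<phi>)
  have body: "\<exists>m \<le> poly (form_time \<phi>) N. call c 3 [enc_form \<phi>, env_tree (v # e), matrix, colours] =
      Some (enc_bool (sat (v # e) \<phi>), m)" if "v < n" for v
    using Exists.IH[of "v # e"] Exists.prems that by simp
  obtain m where m: "m \<le> (n + 1) * (poly (form_time \<phi>) N + 100)"
    "call c 4 [colours, enc_form \<phi>, env_tree e, matrix, colours] =
      Some (enc_bool (\<exists>v<n. sat (v # e) \<phi>), m)"
    using call_ex[OF body, of n] by (auto simp: vertex_n)
  note m(1)
  also have "(n + 1) * (poly (form_time \<phi>) N + 100) \<le> (N + 1) * (poly (form_time \<phi>) N + 100)"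
    using n_le by (intro mult_le_mono1) simp
  finally show ?case using m(2)
    by (subst call_body) (simp add: sat_body_def algebra_simps)
qed

end

section \<open>Correctness and cost of commands\<close>

context coloured_graph
begin

text \<open>The accumulator \<open>bs\<close> is arbitrary: the round for vertex \<open>i\<close>
  puts its bit in front of those already computed for larger vertices.\<close>

lemma call_vec:
  assumes "wf_form (Suc (length e)) \<phi>" and "\<forall>v\<in>set e. v < n"
  shows "i \<le> n \<Longrightarrow> \<exists>m \<le> (i + 1) * (poly (form_time \<phi>) N + 100).
    call c 5 [vertex i, enc_form \<phi>, env_tree e, matrix, colours, enc_list enc_bool bs] =
      Some (enc_list enc_bool (map (\<lambda>v. sat (v # e) \<phi>) [0..<i] @ bs), m)"
proof (induction i arbitrary: bs)
  case 0
  then show ?case by (subst call_body) (simp add: vec_body_def)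
next
  case (Suc i)
  obtain k where k: "k \<le> (i + 1) * (poly (form_time \<phi>) N + 100)"
    "call c 5 [vertex i, enc_form \<phi>, env_tree e, matrix, colours,
        enc_list enc_bool (sat (i # e) \<phi> # bs)] =
      Some (enc_list enc_bool (map (\<lambda>v. sat (v # e) \<phi>) [0..<i] @ (sat (i # e) \<phi> # bs)), k)"
    using Suc.IH[of "sat (i # e) \<phi> # bs"] Suc.prems by auto
  obtain m where m: "m \<le> poly (form_time \<phi>) N"
    "call c 3 [enc_form \<phi>, env_tree (i # e), matrix, colours] =
      Some (enc_bool (sat (i # e) \<phi>), m)"
    using call_sat[of "i # e" \<phi> c] assms Suc.prems by auto
  show ?case using m k Suc.prems
    by (subst call_body) (simp add: vec_body_def vertex_Suc env_tree_Cons algebra_simps)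
qed

abbreviation enc_strokes :: "(nat, nat) stroke list \<Rightarrow> tree" where
  "enc_strokes \<equiv> enc_list enc_vertex_set_stroke"

text \<open>As in \<open>call_ex\<close>, the assumption stands for the induction hypothesis of the
  enclosing induction, here that of \<open>call_run\<close>.\<close>

lemma call_for:
  assumes body: "\<And>v ss. v < n \<Longrightarrow> \<exists>m \<le> B.
      call p 6 [enc_cmd c, env_tree (v # e), matrix, colours, enc_strokes ss] =
        Some (enc_strokes (emitted (v # e) c @ ss), m)"
  shows "i \<le> n \<Longrightarrow> \<exists>m \<le> (i + 1) * (B + 100).
    call p 7 [vertex i, enc_cmd c, env_tree e, matrix, colours, enc_strokes ss] =
      Some (enc_strokes (concat (map (\<lambda>v. emitted (v # e) c) [0..<i]) @ ss), m)"
proof (induction i arbitrary: ss)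
  case 0
  then show ?case by (subst call_body) (simp add: for_body_def)
next
  case (Suc i)
  obtain k where k: "k \<le> (i + 1) * (B + 100)"
    "call p 7 [vertex i, enc_cmd c, env_tree e, matrix, colours,
        enc_strokes (emitted (i # e) c @ ss)] =
      Some (enc_strokes (concat (map (\<lambda>v. emitted (v # e) c) [0..<i]) @ (emitted (i # e) c @ ss)), k)"
    using Suc.IH[of "emitted (i # e) c @ ss"] Suc.prems by auto
  obtain m where m: "m \<le> B"
    "call p 6 [enc_cmd c, env_tree (i # e), matrix, colours, enc_strokes ss] =
        Some (enc_strokes (emitted (i # e) c @ ss), m)"
    using body[of i ss] Suc.prems by auto
  show ?case using m k Suc.prems
    by (subst call_body) (simp add: for_body_def vertex_Suc env_tree_Cons algebra_simps)
qed

lemma call_run: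
  "wf_cmd (length e) c \<Longrightarrow> \<forall>v\<in>set e. v < n \<Longrightarrow>
     \<exists>m \<le> poly (cmd_time c) N.
       call p 6 [enc_cmd c, env_tree e, matrix, colours, enc_strokes ss] =
         Some (enc_strokes (emitted e c @ ss), m)"
proof (induction c arbitrary: e ss)
  case (When \<phi> c)
  obtain m1 where 1: "m1 \<le> poly (form_time \<phi>) N"
    "call p 3 [enc_form \<phi>, env_tree e, matrix, colours] = Some (enc_bool (sat e \<phi>), m1)"
    using call_sat[of e \<phi> p] When.prems by auto
  obtain m2 where 2: "m2 \<le> poly (cmd_time c) N"
    "call p 6 [enc_cmd c, env_tree e, matrix, colours, enc_strokes ss] =
       Some (enc_strokes (emitted e c @ ss), m2)"
    using When.IH[of e ss] When.prems by auto
  from 1 2 show ?case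
    by (subst call_body) (cases "sat e \<phi>"; simp add: run_body_def)
next
  case (For c)
  have body: "\<exists>m \<le> poly (cmd_time c) N.
      call p 6 [enc_cmd c, env_tree (v # e), matrix, colours, enc_strokes ss'] =
        Some (enc_strokes (emitted (v # e) c @ ss'), m)" if "v < n" for v ss'
    using For.IH[of "v # e"] For.prems that by simp
  obtain m where m: "m \<le> (n + 1) * (poly (cmd_time c) N + 100)"
    "call p 7 [colours, enc_cmd c, env_tree e, matrix, colours, enc_strokes ss] =
      Some (enc_strokes (emitted e (For c) @ ss), m)"
    using call_for[OF body, of n ss] by (auto simp: vertex_n)
  note m(1)
  also have "(n + 1) * (poly (cmd_time c) N + 100) \<le> (N + 1) * (poly (cmd_time c) N + 100)"
    using n_le by (intro mult_le_mono1) simp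
  finally show ?case using m(2)
    by (subst call_body) (simp add: run_body_def algebra_simps)
next
  case (Seq c d)
  obtain m1 where 1: "m1 \<le> poly (cmd_time d) N"
    "call p 6 [enc_cmd d, env_tree e, matrix, colours, enc_strokes ss] =
       Some (enc_strokes (emitted e d @ ss), m1)"
    using Seq.IH(2)[of e ss] Seq.prems by auto
  obtain m2 where 2: "m2 \<le> poly (cmd_time c) N"
    "call p 6 [enc_cmd c, env_tree e, matrix, colours, enc_strokes (emitted e d @ ss)] =
       Some (enc_strokes (emitted e c @ emitted e d @ ss), m2)"
    using Seq.IH(1)[of e "emitted e d @ ss"] Seq.prems by auto
  from 1 2 show ?case
    by (subst call_body) (simp add: run_body_def)
next
  case (Emit \<phi> i)
  then have lt: "e ! i < n" by auto
  obtain m1 where 1: "m1 \<le> (n + 1) * (poly (form_time \<phi>) N + 100)"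
    "call p 5 [colours, enc_form \<phi>, env_tree e, matrix, colours, Tip] =
      Some (enc_list enc_bool (map (\<lambda>v. sat (v # e) \<phi>) [0..<n]), m1)"
    using call_vec[of e \<phi> n p "[]"] Emit.prems by (auto simp: vertex_n)
  obtain m2 where 2: "m2 \<le> 8 * (i + 1)"
    "call p (Suc 0) [env_tree e, enc_nat i] = Some (vertex (e ! i), m2)"
    using call_get_env Emit.prems by (meson wf_cmd.simps)
  obtain m3 where 3: "m3 \<le> 8 * (N + 1)"
    "call p (Suc 0) [colours, vertex (e ! i)] = Some (enc_nat (col (e ! i)), m3)"
    using call_get_colours[OF lt] by blast
  note 1(1)
  also have "(n + 1) * (poly (form_time \<phi>) N + 100) \<le> (N + 1) * (poly (form_time \<phi>) N + 100)"
    using n_le by (intro mult_le_mono1) simp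
  finally have 4: "m1 \<le> (N + 1) * (poly (form_time \<phi>) N + 100)" .
  \<comment> \<open>The set in \<open>emitted\<close> carries the bound \<open>v < n\<close>; on the
    range of the vector this bound always holds.\<close>
  have vec: "enc_list enc_bool (map (\<lambda>v. v < n \<and> sat (v # e) \<phi>) [0..<n]) =
      enc_list enc_bool (map (\<lambda>v. sat (v # e) \<phi>) [0..<n])"
    by (rule arg_cong[of _ _ "enc_list enc_bool"]) simp
  from 1(2) 2 3 4 show ?case
    by (subst call_body)
       (simp add: run_body_def enc_vertex_set_stroke_def vec algebra_simps)
qed

end

text \<open>The polynomial depends on the command alone; its constant term includes the cost
  \<open>r\<close> of building the syntax tree.\<close>

lemma interpreter_computes:
  assumes "wf_cmd 0 c"
  shows "\<exists>q. \<forall>n adj col N k. coloured_graph n col N \<longrightarrow>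
    (\<exists>time \<le> poly q N. computes (interpreter c)
       (Bin (coloured_graph.matrix n adj) (Bin k (coloured_graph.colours n col)))
       (enc_list (coloured_graph.enc_vertex_set_stroke n) (coloured_graph.emitted n adj col [] c))
       time)"
proof -
  obtain r where r: "\<And>P env. result P env (quote (enc_cmd c)) = Some (enc_cmd c, r)"
    using result_quote by blast
  have "\<exists>time \<le> poly (cmd_time c + [:r + 100:]) N. computes (interpreter c)
       (Bin (coloured_graph.matrix n adj) (Bin k (coloured_graph.colours n col)))
       (enc_list (coloured_graph.enc_vertex_set_stroke n) (coloured_graph.emitted n adj col [] c))
       time"
    if "coloured_graph n col N" for n adj col N k
  proof -
    interpret coloured_graph n adj col N by fact
    obtain m where m: "m \<le> poly (cmd_time c) N"
      "call c 6 [enc_cmd c, Tip, matrix, colours, Tip] = Some (enc_strokes (emitted [] c), m)"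
      using call_run[of "[]" c c "[]"] assms by (auto simp: env_tree_def)
    then have "\<exists>time \<le> poly (cmd_time c + [:r + 100:]) N.
        call c 0 [Bin matrix (Bin k colours)] = Some (enc_strokes (emitted [] c), time)"
      by (subst call_body) (simp add: main_body_def r)
    then show ?thesis
      by (auto simp: call_def result_eq_Some_iff computes_def interpreter_def)
  qed
  then show ?thesis by blast
qed

section \<open>Connectivity in cographs\<close>

text \<open>The middle vertex is required to lie in \<open>A\<close>, so this is distance at most
  two in the subgraph induced by \<open>A\<close>. Unlike reachability it is first-order
  definable.\<close>

definition within_two :: "'a pair_pre_digraph \<Rightarrow> 'a set \<Rightarrow> 'a \<Rightarrow> 'a \<Rightarrow> bool" where
  "within_two G A u v \<longleftrightarrow>
     u = v \<or> adjacent G u v \<or> (\<exists>w\<in>A. adjacent G u w \<and> adjacent G w v)"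

locale P4_free_graph =
  fixes G :: "'a pair_pre_digraph"
  assumes cograph: "cograph G"
begin

lemma adj_sym: "adjacent G u v \<Longrightarrow> adjacent G v u"
proof -
  interpret pair_graph G using cograph by (simp add: cograph_def)
  assume "adjacent G u v"
  then show ?thesis by (rule arcs_symmetric)
qed

lemma not_adj_self: "\<not> adjacent G u u"
proof -
  interpret pair_graph G using cograph by (simp add: cograph_def)
  show ?thesis using no_loops' by blast
qed

lemma adj_verts: "adjacent G u v \<Longrightarrow> u \<in> pverts G \<and> v \<in> pverts G"
proof -
  interpret pair_graph G using cograph by (simp add: cograph_def)
  assume "adjacent G u v"
  then show ?thesis by (metis in_arcsD1 in_arcsD2)
qed

lemma finite_verts: "finite (pverts G)"
proof -
  interpret pair_graph G using cograph by (simp add: cograph_def)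
  show ?thesis by (rule pair_finite_verts)
qed

text \<open>Distinctness follows from the six assumptions: an equality among the vertices would
  create a loop or turn one of the edges into one of the forbidden chords.\<close>

lemma no_P4:
  assumes "adjacent G a b" "adjacent G b c" "adjacent G c d"
    "\<not> adjacent G a c" "\<not> adjacent G a d" "\<not> adjacent G b d"
  shows False
proof -
  have "distinct [a, b, c, d]"
    using assms adj_sym not_adj_self by auto
  then have "induced_P4 G a b c d"
    using assms adj_verts[OF assms(1)] adj_verts[OF assms(3)] by (auto simp: induced_P4_def)
  then show False using cograph by (auto simp: cograph_def)
qed

lemma connected_set_rtrancl:
  "connected_set G A \<longleftrightarrow> A \<subseteq> pverts G \<and> A \<noteq> {} \<and>
     (\<forall>u\<in>A. \<forall>v\<in>A. (u, v) \<in> rtrancl_on A {(x, y). adjacent G x y \<and> x \<in> A \<and> y \<in> A})"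
proof -
  interpret pair_graph G using cograph by (simp add: cograph_def)
  have "symcl {(x, y). adjacent G x y \<and> x \<in> A \<and> y \<in> A} =
      {(x, y). adjacent G x y \<and> x \<in> A \<and> y \<in> A}"
    using adj_sym by (auto simp: symcl_def)
  moreover have "arcs_ends (with_proj G \<restriction> A) = {(x, y). adjacent G x y \<and> x \<in> A \<and> y \<in> A}"
    by (auto simp: arcs_ends_def induce_subgraph_def arc_to_ends_def)
  ultimately show ?thesis by (auto simp: connected_set_def connected_conv)
qed

text \<open>Induction along a walk in \<open>A\<close>: if \<open>u\<close>, \<open>w\<close>,
  \<open>y\<close> is a path and \<open>z\<close> a neighbour of \<open>y\<close>, then one of the
  chords \<open>uy\<close>, \<open>uz\<close>, \<open>wz\<close> exists, for otherwise the four
  vertices induce a path. So \<open>u\<close> and \<open>z\<close> are again within two.\<close>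

lemma connected_set_iff:
  "connected_set G A \<longleftrightarrow> A \<subseteq> pverts G \<and> A \<noteq> {} \<and> (\<forall>u\<in>A. \<forall>v\<in>A. within_two G A u v)"
proof -
  let ?R = "{(x, y). adjacent G x y \<and> x \<in> A \<and> y \<in> A}"
  have "within_two G A u v" if "(u, v) \<in> rtrancl_on A ?R" for u v
    using that
  proof (induction rule: rtrancl_on_induct)
    case base
    show ?case by (simp add: within_two_def)
  next
    case (step y z)
    then have yz: "adjacent G y z" by simp
    consider "u = y" | "adjacent G u y" | w where "w \<in> A" "adjacent G u w" "adjacent G w y"
      using step.IH by (auto simp: within_two_def)
    then show ?case
    proof cases
      case 1
      then show ?thesis using yz by (simp add: within_two_def)
    next
      case 2
      then show ?thesis using yz \<open>y \<in> A\<close> by (auto simp: within_two_def)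
    next
      case 3
      have "adjacent G u y \<or> adjacent G u z \<or> adjacent G w z"
        using no_P4[OF 3(2,3) yz] by blast
      then show ?thesis using 3 yz \<open>y \<in> A\<close> by (auto simp: within_two_def)
    qed
  qed
  moreover have "(u, v) \<in> rtrancl_on A ?R" if uv: "within_two G A u v" "u \<in> A" "v \<in> A" for u v
  proof -
    consider "u = v" | "adjacent G u v" | w where "w \<in> A" "adjacent G u w" "adjacent G w v"
      using uv(1) by (auto simp: within_two_def)
    then show ?thesis
    proof cases
      case 1
      then show ?thesis using uv by auto
    next
      case 2
      then show ?thesis using uv
        by (intro rtrancl_on_into_rtrancl_on[OF rtrancl_on_refl]) auto
    next
      case 3
      have "(u, w) \<in> rtrancl_on A ?R" using 3 uv
        by (intro rtrancl_on_into_rtrancl_on[OF rtrancl_on_refl]) auto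
      then show ?thesis by (rule rtrancl_on_into_rtrancl_on) (use 3 uv in auto)
    qed
  qed
  ultimately show ?thesis unfolding connected_set_rtrancl by blast
qed

text \<open>By the distance bound this is the connected component of the vertex \<open>a\<close>, in
  a form that a first-order formula can express.\<close>

definition component :: "'a \<Rightarrow> 'a set" where
  "component a = {v \<in> pverts G. within_two G (pverts G) a v}"

lemma component_self: "a \<in> pverts G \<Longrightarrow> a \<in> component a"
  by (simp add: component_def within_two_def)

lemma component_subset: "component a \<subseteq> pverts G"
  by (auto simp: component_def)

lemma within_two_sym: "within_two G A u v \<Longrightarrow> within_two G A v u"
  unfolding within_two_def using adj_sym by blast

lemma within_two_adj:
  assumes "within_two G (pverts G) u y" "adjacent G y z"
  shows "within_two G (pverts G) u z"
proof -
  consider "u = y" | "adjacent G u y" | w where "adjacent G u w" "adjacent G w y"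
    using assms(1) by (auto simp: within_two_def)
  then show ?thesis
  proof cases
    case 3
    have "adjacent G u y \<or> adjacent G u z \<or> adjacent G w z"
      using no_P4[OF 3 assms(2)] by blast
    then show ?thesis using 3 assms adj_verts by (auto simp: within_two_def)
  qed (use assms adj_verts in \<open>auto simp: within_two_def\<close>)
qed

lemma within_two_trans:
  assumes "within_two G (pverts G) u v" "within_two G (pverts G) v w"
  shows "within_two G (pverts G) u w"
proof -
  consider "v = w" | "adjacent G v w" | x where "adjacent G v x" "adjacent G x w"
    using assms(2) by (auto simp: within_two_def)
  then show ?thesis by cases (use assms(1) within_two_adj in blast)+
qed

lemma component_eq: "v \<in> component a \<Longrightarrow> component v = component a"
proof -
  assume "v \<in> component a"
  then have "within_two G (pverts G) a v" "within_two G (pverts G) v a"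
    using within_two_sym by (auto simp: component_def)
  then have "within_two G (pverts G) v x \<longleftrightarrow> within_two G (pverts G) a x" for x
    using within_two_trans by blast
  then show ?thesis by (simp add: component_def)
qed

lemma component_sym: "v \<in> component a \<Longrightarrow> a \<in> pverts G \<Longrightarrow> a \<in> component v"
  using component_eq component_self by metis

lemma adj_component: "adjacent G a v \<Longrightarrow> v \<in> component a"
  using adj_verts by (auto simp: component_def within_two_def)

lemma connected_set_subset_component:
  assumes "connected_set G A" "v \<in> A"
  shows "A \<subseteq> component v"
proof
  fix x
  assume "x \<in> A"
  with assms have "A \<subseteq> pverts G" "within_two G A v x" "x \<in> pverts G"
    by (auto simp: connected_set_iff)
  then show "x \<in> component v" unfolding component_def within_two_def by blast
qed

text \<open>A connected pair dominating the component of \<open>a\<close>. The case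
  \<open>b = a\<close> serves vertices that dominate their component alone, such as isolated
  ones.\<close>

definition hub :: "'a \<Rightarrow> 'a \<Rightarrow> bool" where
  "hub a b \<longleftrightarrow> b \<in> pverts G \<and> (b = a \<or> adjacent G a b) \<and>
     (\<forall>w\<in>component a. w = a \<or> w = b \<or> adjacent G a w \<or> adjacent G b w)"

text \<open>An extremal choice: among the neighbours of \<open>a\<close>, the vertex
  \<open>b\<close> has the most neighbours outside the neighbourhood of \<open>a\<close>. A vertex
  missed by both \<open>a\<close> and \<open>b\<close> would produce an induced path on four
  vertices.\<close>

lemma hub_exists:
  assumes a: "a \<in> pverts G"
  shows "\<exists>b. hub a b"
proof (cases "\<forall>w\<in>component a. w = a \<or> adjacent G a w")
  case True
  then show ?thesis using a by (intro exI[of _ a]) (auto simp: hub_def)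
next
  case False
  define D where "D b = {w \<in> pverts G. adjacent G b w \<and> \<not> adjacent G a w}" for b
  have D_verts: "D b \<subseteq> pverts G" for b by (auto simp: D_def)
  from False obtain w0 where "w0 \<in> component a" "w0 \<noteq> a" "\<not> adjacent G a w0" by blast
  then obtain x0 where "adjacent G a x0" by (auto simp: component_def within_two_def)
  let ?S = "{x \<in> pverts G. adjacent G a x}"
  have "Max ((\<lambda>x. card (D x)) ` ?S) \<in> (\<lambda>x. card (D x)) ` ?S"
    using finite_verts adj_verts \<open>adjacent G a x0\<close> by (intro Max_in) auto
  then obtain b where b: "adjacent G a b" and b_max: "Max ((\<lambda>x. card (D x)) ` ?S) = card (D b)"
    by auto
  have max: "card (D x) \<le> card (D b)" if "adjacent G a x" for x
    unfolding b_max[symmetric] using that adj_verts finite_verts by (intro Max_ge) auto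
  have "adjacent G b w" if w: "w \<in> component a" "w \<noteq> a" "\<not> adjacent G a w" for w
  proof (rule ccontr)
    assume nbw: "\<not> adjacent G b w"
    from w obtain x where x: "adjacent G a x" "adjacent G x w"
      by (auto simp: component_def within_two_def)
    have wD: "w \<in> D x" "w \<notin> D b" using w x nbw adj_verts by (auto simp: D_def)
    \<comment> \<open>Since \<open>w\<close> lies in \<open>D x\<close> but not in
      \<open>D b\<close>, the maximality of \<open>b\<close> forces some \<open>y\<close> in
      \<open>D b\<close> outside \<open>D x\<close>.\<close>
    have "\<not> D b \<subseteq> D x"
    proof
      assume "D b \<subseteq> D x"
      with wD have "D b \<subset> D x" by blast
      then have "card (D b) < card (D x)"
        using D_verts finite_verts by (metis finite_subset psubset_card_mono)
      with max[OF x(1)] show False by simp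
    qed
    then obtain y where y: "adjacent G b y" "\<not> adjacent G a y" "\<not> adjacent G x y"
      by (auto simp: D_def)
    \<comment> \<open>Depending on the pairs \<open>bx\<close> and \<open>yw\<close>, the induced
      path is \<open>y b a x\<close>, \<open>a b y w\<close> or \<open>y b x w\<close>.\<close>
    show False
    proof (cases "adjacent G b x")
      case False
      then show False using no_P4[of y b a x] y b x adj_sym by blast
    next
      case bx: True
      show False
      proof (cases "adjacent G y w")
        case True
        then show False using no_P4[of a b y w] b y w nbw by blast
      next
        case False
        then show False using no_P4[of y b x w] y bx x nbw adj_sym by blast
      qed
    qed
  qed
  then have "hub a b" using b adj_verts by (auto simp: hub_def)
  then show ?thesis ..
qed

lemma hub_in_component: "hub a b \<Longrightarrow> a \<in> pverts G \<Longrightarrow> b \<in> component a"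
  using adj_component component_self by (auto simp: hub_def)

text \<open>Inside \<open>A\<close> every vertex reaches \<open>a\<close>, directly or through
  \<open>b\<close>. Apart from containing the pair, \<open>A\<close> is an arbitrary part of the
  component, so any colour class can be painted in one stroke once the pair is added.\<close>

lemma hub_connected:
  assumes a: "a \<in> pverts G" and hub: "hub a b" and A: "A \<subseteq> component a" "a \<in> A" "b \<in> A"
  shows "connected_set G A"
proof -
  have ab: "b = a \<or> adjacent G a b" using hub by (simp add: hub_def)
  have near: "u = a \<or> u = b \<or> adjacent G a u \<or> adjacent G b u" if "u \<in> A" for u
    using hub that A by (auto simp: hub_def)
  let ?R = "{(x, y). adjacent G x y \<and> x \<in> A \<and> y \<in> A}"
  have edge: "(x, y) \<in> rtrancl_on A ?R" if "adjacent G x y" "x \<in> A" "y \<in> A" for x y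
    using that by (intro rtrancl_on_into_rtrancl_on[OF rtrancl_on_refl]) auto
  have refl: "(x, x) \<in> rtrancl_on A ?R" if "x \<in> A" for x
    using that by (rule rtrancl_on_refl)
  have ab_path: "(a, b) \<in> rtrancl_on A ?R" "(b, a) \<in> rtrancl_on A ?R"
    using ab edge[of a b] edge[of b a] refl[of a] adj_sym[of a b] A by blast+
  have from_a: "(a, u) \<in> rtrancl_on A ?R" if u: "u \<in> A" for u
  proof -
    have "(a, u) \<in> rtrancl_on A ?R \<or> (b, u) \<in> rtrancl_on A ?R"
      using near[OF u] edge[of a u] edge[of b u] refl[of a] refl[of b] u A by blast
    then show ?thesis using rtrancl_on_trans[OF ab_path(1)] by blast
  qed
  have to_a: "(u, a) \<in> rtrancl_on A ?R" if u: "u \<in> A" for u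
  proof -
    have "(u, a) \<in> rtrancl_on A ?R \<or> (u, b) \<in> rtrancl_on A ?R"
      using near[OF u] edge[of u a] edge[of u b] refl[of a] refl[of b] u A
        adj_sym[of a u] adj_sym[of b u] by blast
    then show ?thesis using rtrancl_on_trans[OF _ ab_path(2)] by blast
  qed
  show ?thesis unfolding connected_set_rtrancl
    using A component_subset[of a] rtrancl_on_trans[OF to_a from_a] by blast
qed

end

section \<open>Optimal plans for cographs\<close>

lemma apply_stroke_apply: "apply_stroke s p v = (if v \<in> fst s then Some (snd s) else p v)"
  by (simp add: apply_stroke_def)

lemma fold_apply_stroke_other:
  "\<forall>s\<in>set ss. v \<notin> fst s \<Longrightarrow> fold apply_stroke ss p v = p v"
  by (induction ss arbitrary: p) (simp_all add: apply_stroke_apply)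

lemma fold_apply_stroke_same:
  "\<forall>s\<in>set ss. v \<in> fst s \<longrightarrow> snd s = c \<Longrightarrow> s \<in> set ss \<Longrightarrow> v \<in> fst s \<Longrightarrow>
     fold apply_stroke ss p v = Some c"
proof (induction ss rule: rev_induct)
  case (snoc r ss)
  then show ?case by (cases "v \<in> fst r") (auto simp: apply_stroke_apply)
qed simp

lemma fold_apply_stroke_Some:
  "fold apply_stroke ss Map.empty v = Some c \<Longrightarrow> \<exists>s\<in>set ss. v \<in> fst s \<and> snd s = c"
  by (induction ss rule: rev_induct) (auto simp: apply_stroke_apply split: if_splits)

text \<open>The discarded strokes avoid \<open>v\<close>. This restricts a plan to the strokes
  inside one component.\<close>

lemma fold_apply_stroke_filter:
  "\<forall>s\<in>set ss. v \<in> fst s \<longrightarrow> P s \<Longrightarrow>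
     fold apply_stroke ss p v = fold apply_stroke (filter P ss) p v"
proof (induction ss rule: rev_induct)
  case (snoc r ss)
  then show ?case by (cases "P r") (auto simp: apply_stroke_apply)
qed simp

text \<open>Double counting: each stroke is counted for at most one index. It adds up the lower
  bounds of the components.\<close>

lemma sum_length_filter_le:
  assumes "finite A" and "\<And>s a b. s \<in> set ss \<Longrightarrow> a \<in> A \<Longrightarrow> b \<in> A \<Longrightarrow> P a s \<Longrightarrow> P b s \<Longrightarrow> a = b"
  shows "(\<Sum>a\<in>A. length (filter (P a) ss)) \<le> length ss"
  using assms(2)
proof (induction ss)
  case (Cons s ss)
  have "card {a \<in> A. P a s} \<le> Suc 0"
    using assms(1) Cons.prems by (subst card_le_Suc0_iff_eq) auto
  moreover have "(\<Sum>a\<in>A. length (filter (P a) ss)) \<le> length ss"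
    using Cons by auto
  moreover have "(\<Sum>a\<in>A. length (filter (P a) (s # ss))) =
      (\<Sum>a\<in>A. (if P a s then 1 else 0) + length (filter (P a) ss))"
    by (rule sum.cong) auto
  moreover have "(\<Sum>a\<in>A. if P a s then 1 else 0) = card {a \<in> A. P a s}"
    using assms(1) by (simp flip: sum.inter_filter)
  ultimately show ?case by (simp add: sum.distrib)
qed simp

section \<open>The plan, component by component\<close>

locale painted_cograph = P4_free_graph G for G :: "nat pair_pre_digraph" +
  fixes n :: nat and T :: "nat \<Rightarrow> nat"
  assumes verts: "pverts G = {..<n}"
begin

definition colour_class :: "nat \<Rightarrow> nat set" where
  "colour_class a = {u \<in> component a. T u = T a}"

definition tidy :: "nat \<Rightarrow> bool" where
  "tidy a \<longleftrightarrow> connected_set G (colour_class a)"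

text \<open>Such a vertex may carry the last stroke of its component: a tidy one if there is any,
  which saves the additional stroke, and otherwise an arbitrary one.\<close>

definition last_candidate :: "nat \<Rightarrow> bool" where
  "last_candidate a \<longleftrightarrow> tidy a \<or> (\<forall>u\<in>component a. \<not> tidy u)"

definition chosen :: "nat \<Rightarrow> bool" where
  "chosen a \<longleftrightarrow> last_candidate a \<and> (\<forall>u\<in>component a. u < a \<longrightarrow> \<not> last_candidate u)"

definition first_hub :: "nat \<Rightarrow> nat" where
  "first_hub a = (LEAST b. hub a b)"

definition core :: "nat \<Rightarrow> nat set" where
  "core a = {a, first_hub a}"

text \<open>The least vertex represents its colour, so a loop over the vertices meets every colour
  of a component exactly once.\<close>

definition first_of_class :: "nat \<Rightarrow> bool" where
  "first_of_class w \<longleftrightarrow> (\<forall>u\<in>component w. u < w \<longrightarrow> T u \<noteq> T w)"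

text \<open>
  The core of \<open>a\<close> dominates its component, so together with any part of the component it is
  connected. Only the colour of \<open>a\<close> may need two strokes: the other colours repaint the core, and
  the colour of the second core vertex comes last among them.
\<close>

definition block :: "nat \<Rightarrow> (nat, nat) stroke list" where
  "block a =
     (if tidy a then [] else [(core a \<union> colour_class a, T a)]) @
     map (\<lambda>w. (core a \<union> colour_class w, T w))
       (filter (\<lambda>w. w \<in> component a \<and> T w \<noteq> T a \<and> T w \<noteq> T (first_hub a) \<and> first_of_class w) [0..<n]) @
     (if T (first_hub a) = T a then [] else [(core a \<union> colour_class (first_hub a), T (first_hub a))]) @
     [(if tidy a then colour_class a else {a}, T a)]"

definition plan :: "(nat, nat) stroke list" where
  "plan = concat (map block (filter chosen [0..<n]))"

lemma colour_class_eq: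
  "v \<in> component a \<Longrightarrow> colour_class v = {u \<in> component a. T u = T v}"
  using component_eq by (auto simp: colour_class_def)

lemma hub_first_hub: "a < n \<Longrightarrow> hub a (first_hub a)"
  unfolding first_hub_def using hub_exists[of a] verts by (auto intro: LeastI)

lemma first_hub_in_component: "a < n \<Longrightarrow> first_hub a \<in> component a"
  using hub_in_component hub_first_hub verts by simp

lemma component_less: "v \<in> component a \<Longrightarrow> v < n"
  using component_subset verts by blast

lemma finite_component: "finite (component a)"
  by (rule finite_subset[OF component_subset finite_verts])

lemma core_connected:
  assumes "a < n" "A \<subseteq> component a"
  shows "connected_set G (core a \<union> A)"
proof (rule hub_connected)
  show "hub a (first_hub a)" by (rule hub_first_hub) fact
  show "core a \<union> A \<subseteq> component a"
    using assms first_hub_in_component component_self verts by (auto simp: core_def)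
qed (use assms verts in \<open>auto simp: core_def\<close>)

text \<open>Here the core is part of the colour class of \<open>a\<close> and connects it. Hence an
  untidy \<open>a\<close> has a hub of another colour, whose stroke in \<open>block\<close> repairs
  the hub.\<close>

lemma tidy_if_hub_same_colour:
  assumes "a < n" "T (first_hub a) = T a"
  shows "tidy a"
proof -
  have "core a \<union> colour_class a = colour_class a"
    using assms first_hub_in_component component_self verts
    by (auto simp: core_def colour_class_def)
  then show ?thesis
    using core_connected[of a "colour_class a"] assms by (auto simp: tidy_def colour_class_def)
qed

lemma chosen_exists:
  assumes "v < n"
  shows "\<exists>a. chosen a \<and> v \<in> component a"
proof -
  let ?Q = "\<lambda>u. u \<in> component v \<and> last_candidate u"
  have "\<exists>u. ?Q u"
    using component_self[of v] verts assms by (auto simp: last_candidate_def)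
  then have a: "?Q (LEAST u. ?Q u)" by (rule LeastI_ex)
  define a where "a = (LEAST u. ?Q u)"
  from a have a: "a \<in> component v" "last_candidate a" by (simp_all add: a_def)
  have "\<not> last_candidate u" if "u \<in> component a" "u < a" for u
    using not_less_Least[of u ?Q] that component_eq[OF a(1)] by (simp add: a_def)
  then have "chosen a" using a by (simp add: chosen_def)
  moreover have "v \<in> component a" using component_sym[OF a(1)] verts assms by simp
  ultimately show ?thesis by blast
qed

lemma chosen_unique:
  assumes "chosen a" "chosen b" "v \<in> component a" "v \<in> component b" "a < n" "b < n"
  shows "a = b"
proof -
  have "component a = component b" using assms component_eq by metis
  moreover have "a \<in> component a" "b \<in> component b"
    using assms component_self verts by auto
  ultimately show ?thesis
    using assms by (metis chosen_def linorder_neqE_nat)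
qed

lemma block_strokes:
  assumes "a < n" "s \<in> set (block a)"
  shows "connected_set G (fst s)" "fst s \<subseteq> component a" "snd s \<in> T ` {..<n}"
proof -
  have sub: "colour_class w \<subseteq> component a" if "w \<in> component a" for w
    using colour_class_eq[OF that] by blast
  have self: "a \<in> component a" using assms component_self verts by simp
  have hub: "first_hub a \<in> component a" using assms first_hub_in_component by simp
  have core: "core a \<subseteq> component a" using self hub by (simp add: core_def)
  have "connected_set G {a}" using assms verts by (auto simp: connected_set_iff within_two_def)
  then show "connected_set G (fst s)"
    using assms(2) core_connected[OF assms(1) sub] self hub
    by (auto simp: block_def tidy_def split: if_splits)
  show "fst s \<subseteq> component a"
    using assms(2) self sub[OF self] sub[OF hub] core
    by (auto simp: block_def dest: subsetD[OF sub] split: if_splits)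
  show "snd s \<in> T ` {..<n}"
    using assms component_less[OF hub] by (auto simp: block_def split: if_splits)
qed

text \<open>The painting \<open>p\<close> is arbitrary, so a block overrides whatever came before
  it. The cases follow the last stroke of the block that contains \<open>v\<close>.\<close>

lemma block_paints:
  assumes a: "a < n" and v: "v \<in> component a"
  shows "fold apply_stroke (block a) p v = Some (T v)"
proof -
  let ?h = "first_hub a"
  define L1 where "L1 = map (\<lambda>w. (core a \<union> colour_class w, T w))
       (filter (\<lambda>w. w \<in> component a \<and> T w \<noteq> T a \<and> T w \<noteq> T ?h \<and> first_of_class w) [0..<n])"
  let ?L2 = "if T ?h = T a then [] else [(core a \<union> colour_class ?h, T ?h)]"
  let ?L3 = "[(if tidy a then colour_class a else {a}, T a)]"
  define q where "q = fold apply_stroke (if tidy a then [] else [(core a \<union> colour_class a, T a)]) p"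
  have fold: "fold apply_stroke (block a) p =
      fold apply_stroke ?L3 (fold apply_stroke ?L2 (fold apply_stroke L1 q))"
    by (simp add: block_def q_def L1_def)
  have self: "a \<in> component a" using assms component_self verts by simp
  have hub: "?h \<in> component a" using a first_hub_in_component by simp
  have class_a: "u \<in> colour_class a \<longleftrightarrow> u \<in> component a \<and> T u = T a" for u
    by (simp add: colour_class_def)
  have class_h: "u \<in> colour_class ?h \<longleftrightarrow> u \<in> component a \<and> T u = T ?h" for u
    using colour_class_eq[OF hub] by simp
  show ?thesis
  proof (cases "v = a \<or> T v = T a \<and> tidy a")
    case True
    then have "v \<in> (if tidy a then colour_class a else {a})" "T v = T a"
      using v by (auto simp: class_a)
    then show ?thesis unfolding fold by (simp add: apply_stroke_apply)
  next
    case F: False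
    then have "v \<notin> (if tidy a then colour_class a else {a})"
      by (auto simp: class_a)
    then have L3: "fold apply_stroke ?L3 p' v = p' v" for p'
      by (simp add: apply_stroke_apply)
    show ?thesis
    proof (cases "v = ?h \<or> T v = T ?h \<and> T v \<noteq> T a")
      case True
      \<comment> \<open>Were the colours equal, \<open>a\<close> would be tidy and \<open>v\<close>
        would have been painted by the final stroke.\<close>
      then have "T ?h \<noteq> T a" using F tidy_if_hub_same_colour[OF a] by auto
      moreover have "v \<in> core a \<union> colour_class ?h" "T v = T ?h"
        using v True unfolding class_h core_def Un_iff by blast+
      ultimately show ?thesis unfolding fold L3 by (simp add: apply_stroke_apply)
    next
      case H: False
      then have "v \<notin> core a \<union> colour_class ?h \<or> T ?h = T a"
        using F unfolding class_h core_def Un_iff by auto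
      then have L2: "fold apply_stroke ?L2 p' v = p' v" for p'
        by (auto simp: apply_stroke_apply)
      have v_core: "v \<notin> core a" using F H by (simp add: core_def)
      show ?thesis
      proof (cases "T v = T a")
        case True
        \<comment> \<open>Here \<open>a\<close> is not tidy, and its class received its colour from
          the first stroke. The strokes of \<open>L1\<close> have other colours and meet this class
          only in the core.\<close>
        have "fold apply_stroke L1 q v = q v"
          using True v_core by (intro fold_apply_stroke_other) (auto simp: L1_def colour_class_def)
        then show ?thesis using True F v unfolding fold L3 L2
          by (simp add: q_def apply_stroke_apply class_a)
      next
        case False
        define w where "w = (LEAST u. u \<in> component a \<and> T u = T v)"
        have w: "w \<in> component a" "T w = T v"
          using LeastI[of "\<lambda>u. u \<in> component a \<and> T u = T v" v] v unfolding w_def by blast+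
        have "\<not> (u \<in> component a \<and> T u = T v)" if "u < w" for u
          using that unfolding w_def by (rule not_less_Least)
        then have "first_of_class w"
          using component_eq[OF w(1)] w(2) by (auto simp: first_of_class_def)
        moreover have "T w \<noteq> T a" "T w \<noteq> T ?h" using w(2) H False by auto
        ultimately have in_L1: "(core a \<union> colour_class w, T w) \<in> set L1"
          using w(1) component_less[OF w(1)] by (simp add: L1_def)
        have "v \<in> colour_class w"
          using w v unfolding colour_class_eq[OF w(1)] by simp
        then have "v \<in> fst (core a \<union> colour_class w, T w)" by simp
        \<comment> \<open>Outside the core the strokes of \<open>L1\<close> meet only their own
          colour classes, so their order is immaterial for \<open>v\<close>.\<close>
        moreover have "\<forall>s\<in>set L1. v \<in> fst s \<longrightarrow> snd s = T v"
          using v_core by (auto simp: L1_def colour_class_def)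
        ultimately have "fold apply_stroke L1 q v = Some (T v)"
          using fold_apply_stroke_same[OF _ in_L1] by simp
        then show ?thesis unfolding fold L3 L2 .
      qed
    qed
  qed
qed

lemma fold_blocks:
  "\<forall>a\<in>set as. a < n \<Longrightarrow> fold apply_stroke (concat (map block as)) p v =
     (if \<exists>a\<in>set as. v \<in> component a then Some (T v) else p v)"
proof (induction as arbitrary: p)
  case (Cons a as)
  show ?case
  proof (cases "v \<in> component a")
    case True
    then show ?thesis using Cons by (simp add: block_paints)
  next
    case False
    have "fold apply_stroke (block a) p v = p v"
      using False block_strokes(2)[of a] Cons.prems by (intro fold_apply_stroke_other) auto
    then show ?thesis using Cons False by simp
  qed
qed simp

lemma plan_paints: "fold apply_stroke plan Map.empty v = (if v < n then Some (T v) else None)"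
proof -
  have "(\<exists>a\<in>set (filter chosen [0..<n]). v \<in> component a) \<longleftrightarrow> v < n"
  proof
    assume "v < n"
    then obtain a where a: "chosen a" "v \<in> component a" using chosen_exists by blast
    \<comment> \<open>\<open>component\<close> is defined for all numbers: one that is not a vertex
      is within two of itself only.\<close>
    have "a < n"
    proof (rule ccontr)
      assume "\<not> a < n"
      then have "v = a" using a(2) verts adj_verts by (auto simp: component_def within_two_def)
      with \<open>v < n\<close> \<open>\<not> a < n\<close> show False by simp
    qed
    with a show "\<exists>a\<in>set (filter chosen [0..<n]). v \<in> component a" by auto
  qed (auto dest: component_less)
  then show ?thesis unfolding plan_def by (subst fold_blocks) auto
qed

text \<open>The least vertices of the classes match the colours other than those of \<open>a\<close>
  and its hub. The remaining strokes account for these one or two colours, with the colour of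
  \<open>a\<close> used twice if \<open>a\<close> is not tidy.\<close>

lemma length_block:
  assumes a: "a < n"
  shows "length (block a) = card (T ` component a) + (if tidy a then 0 else 1)"
proof -
  let ?h = "first_hub a"
  let ?W = "{w \<in> component a. T w \<noteq> T a \<and> T w \<noteq> T ?h \<and> first_of_class w}"
  have self: "a \<in> component a" using assms component_self verts by simp
  have hub: "?h \<in> component a" using a first_hub_in_component by simp
  have "length (filter (\<lambda>w. w \<in> component a \<and> T w \<noteq> T a \<and> T w \<noteq> T ?h \<and> first_of_class w) [0..<n]) =
      card ?W"
    using component_less by (auto simp: length_filter_conv_card intro!: arg_cong[of _ _ card])
  also have "card ?W = card (T ` ?W)"
  proof (rule card_image[symmetric], rule inj_onI)
    fix x y assume xy: "x \<in> ?W" "y \<in> ?W" "T x = T y"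
    then have "component x = component a" "component y = component a" using component_eq by auto
    then have "\<not> x < y" "\<not> y < x" using xy by (auto simp: first_of_class_def)
    then show "x = y" by simp
  qed
  also have "T ` ?W = T ` component a - {T a, T ?h}"
  proof
    show "T ` component a - {T a, T ?h} \<subseteq> T ` ?W"
    proof
      fix c assume c: "c \<in> T ` component a - {T a, T ?h}"
      define w where "w = (LEAST u. u \<in> component a \<and> T u = c)"
      have w: "w \<in> component a" "T w = c"
        using c LeastI[of "\<lambda>u. u \<in> component a \<and> T u = c"] by (auto simp: w_def)
      have "\<not> (u \<in> component a \<and> T u = c)" if "u < w" for u
        using that unfolding w_def by (rule not_less_Least)
      then have "first_of_class w"
        using component_eq[OF w(1)] w(2) by (auto simp: first_of_class_def)
      then show "c \<in> T ` ?W" using w c by auto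
    qed
  qed auto
  also have "card (T ` component a - {T a, T ?h}) = card (T ` component a) - card {T a, T ?h}"
    using self hub by (intro card_Diff_subset) auto
  finally have len: "length (filter (\<lambda>w. w \<in> component a \<and> T w \<noteq> T a \<and> T w \<noteq> T ?h \<and> first_of_class w) [0..<n]) =
      card (T ` component a) - card {T a, T ?h}" .
  have "card {T a, T ?h} \<le> card (T ` component a)"
    using self hub finite_component by (intro card_mono) auto
  then show ?thesis using len tidy_if_hub_same_colour[OF a]
    by (cases "T ?h = T a"; cases "tidy a") (auto simp: block_def)
qed

text \<open>A connected stroke that meets the component stays inside it, so the strokes in
  \<open>L\<close> paint the component by themselves and use all its colours. If \<open>a\<close> is
  not tidy and no colour were repeated, the last stroke would be an entire colour class, making some
  vertex tidy against the choice of \<open>a\<close>.\<close>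

lemma component_strokes_lower_bound:
  assumes strokes: "\<forall>s\<in>set ss. connected_set G (fst s)"
    and paints: "\<And>v. v < n \<Longrightarrow> fold apply_stroke ss Map.empty v = Some (T v)"
    and a: "a < n" "chosen a"
  shows "length (block a) \<le> length (filter (\<lambda>s. fst s \<subseteq> component a) ss)"
proof -
  define L where "L = filter (\<lambda>s. fst s \<subseteq> component a) ss"
  have L: "fold apply_stroke L Map.empty v = Some (T v)" if v: "v \<in> component a" for v
  proof -
    have "\<forall>s\<in>set ss. v \<in> fst s \<longrightarrow> fst s \<subseteq> component a"
    proof (intro ballI impI)
      fix s assume "s \<in> set ss" "v \<in> fst s"
      then show "fst s \<subseteq> component a"
        using connected_set_subset_component[of "fst s" v] strokes component_eq[OF v] by simp
    qed
    from fold_apply_stroke_filter[OF this, of Map.empty] paints[OF component_less[OF v]]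
    show ?thesis by (simp add: L_def)
  qed
  have ex: "\<exists>s\<in>set L. v \<in> fst s \<and> snd s = T v" if "v \<in> component a" for v
    using fold_apply_stroke_Some[OF L[OF that]] .
  have "T ` component a \<subseteq> set (map snd L)"
  proof
    fix c assume "c \<in> T ` component a"
    then obtain s where "s \<in> set L" "snd s = c" using ex by blast
    then show "c \<in> set (map snd L)" by auto
  qed
  then have le: "card (T ` component a) \<le> card (set (map snd L))" by (intro card_mono) auto
  have card_le: "card (set (map snd L)) \<le> length L" using card_length[of "map snd L"] by simp
  have "card (T ` component a) + 1 \<le> length L" if "\<not> tidy a"
  proof (rule ccontr)
    assume "\<not> ?thesis"
    then have "card (set (map snd L)) = length (map snd L)"
      using le card_le unfolding length_map by linarith
    \<comment> \<open>All inequalities are tight, so different strokes of \<open>L\<close> have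
      different colours.\<close>
    then have dist: "distinct (map snd L)" by (rule card_distinct)
    have "a \<in> component a" using component_self a(1) verts by simp
    from ex[OF this] obtain r where "r \<in> set L" ..
    then have "L \<noteq> []" using length_pos_if_in_set[of r L] by simp
    then obtain L' s where Ls: "L = L' @ [s]"
      using append_butlast_last_id[of L, symmetric] by blast
    have s: "s \<in> set L" unfolding Ls by simp
    then have s': "connected_set G (fst s)" "fst s \<subseteq> component a" using strokes by (auto simp: L_def)
    then obtain u where u: "u \<in> fst s" by (auto simp: connected_set_iff)
    \<comment> \<open>Nothing in \<open>L\<close> comes after \<open>s\<close>, so its colour stays
      visible on all of its vertices.\<close>
    have T_s: "T v = snd s" if "v \<in> fst s" for v
    proof -
      have "v \<in> component a" using s'(2) that by blast
      from L[OF this] that show ?thesis by (simp add: Ls apply_stroke_apply)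
    qed
    \<comment> \<open>Some stroke of this colour covers \<open>v\<close>, and \<open>s\<close> is
      the only one of its colour.\<close>
    have "v \<in> fst s" if v: "v \<in> component a" "T v = snd s" for v
    proof -
      from ex[OF v(1)] v(2) obtain r where r: "r \<in> set L" "v \<in> fst r" "snd r = snd s" by auto
      have "inj_on snd (set L)" using dist by (simp add: distinct_map)
      then have "r = s" using r(3,1) s by (rule inj_onD)
      with r show ?thesis by simp
    qed
    then have "fst s = colour_class u"
      using colour_class_eq[OF subsetD[OF s'(2) u]] u s'(2) T_s by auto
    with s' u have "tidy u" "u \<in> component a" by (auto simp: tidy_def)
    with a(2) that show False by (auto simp: chosen_def last_candidate_def)
  qed
  with le card_le show ?thesis
    unfolding length_block[OF a(1)] L_def[symmetric] by auto
qed

lemma length_plan: "length plan = (\<Sum>a | a < n \<and> chosen a. length (block a))"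
proof -
  have "length plan = (\<Sum>a\<leftarrow>filter chosen [0..<n]. length (block a))"
    by (simp add: plan_def length_concat comp_def)
  also have "\<dots> = (\<Sum>a\<in>set (filter chosen [0..<n]). length (block a))"
    by (rule sum_list_distinct_conv_sum_set) simp
  also have "set (filter chosen [0..<n]) = {a. a < n \<and> chosen a}" by auto
  finally show ?thesis .
qed

lemma optimal_plan:
  assumes n: "n \<ge> 1" and t: "\<And>v. t v = (if v < n then Some (T v) else None)"
    and C: "T ` {..<n} \<subseteq> C"
  shows "optimal_paint_plan G C t plan"
proof -
  have paints: "fold apply_stroke plan Map.empty = t"
    by (rule ext) (simp only: plan_paints t)
  have "plan \<noteq> []"
  proof
    assume "plan = []"
    then show False using plan_paints[of 0] n by simp
  qed
  moreover have "is_stroke G C s" if "s \<in> set plan" for s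
  proof -
    from that obtain a where "a < n" "s \<in> set (block a)" by (auto simp: plan_def)
    from block_strokes[OF this] show ?thesis using C by (auto simp: is_stroke_def)
  qed
  ultimately have "paint_plan G C t plan" using paints by (simp add: paint_plan_def)
  moreover have "length plan \<le> length ss" if plan: "paint_plan G C t ss" for ss
  proof -
    have strokes: "\<forall>s\<in>set ss. connected_set G (fst s)"
      using plan by (simp add: paint_plan_def is_stroke_def)
    have "fold apply_stroke ss Map.empty v = Some (T v)" if "v < n" for v
      using plan t that by (simp add: paint_plan_def)
    note lower = component_strokes_lower_bound[OF strokes this]
    have "length plan \<le> (\<Sum>a | a < n \<and> chosen a. length (filter (\<lambda>s. fst s \<subseteq> component a) ss))"
      unfolding length_plan by (rule sum_mono) (use lower in auto)
    also have "\<dots> \<le> length ss"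
    proof (rule sum_length_filter_le)
      fix s a b
      assume s: "s \<in> set ss" "fst s \<subseteq> component a" "fst s \<subseteq> component b"
        and ab: "a \<in> {a. a < n \<and> chosen a}" "b \<in> {a. a < n \<and> chosen a}"
      have "connected_set G (fst s)" using s(1) strokes by simp
      \<comment> \<open>Connected sets are nonempty, so a stroke cannot lie in two different
        components.\<close>
      then obtain v where v: "v \<in> fst s" by (auto simp: connected_set_iff)
      show "a = b"
        using ab chosen_unique[of a b, OF _ _ subsetD[OF s(2) v] subsetD[OF s(3) v]] by simp
    qed simp
    finally show ?thesis .
  qed
  ultimately show ?thesis by (simp add: optimal_paint_plan_def)
qed

end

section \<open>First-order definition of the plan\<close>

definition neg_form :: "form \<Rightarrow> form" where
  "neg_form \<phi> = Nand \<phi> \<phi>"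

definition conj_form :: "form \<Rightarrow> form \<Rightarrow> form" where
  "conj_form \<phi> \<psi> = neg_form (Nand \<phi> \<psi>)"

definition disj_form :: "form \<Rightarrow> form \<Rightarrow> form" where
  "disj_form \<phi> \<psi> = Nand (neg_form \<phi>) (neg_form \<psi>)"

definition imp_form :: "form \<Rightarrow> form \<Rightarrow> form" where
  "imp_form \<phi> \<psi> = Nand \<phi> (neg_form \<psi>)"

definition all_form :: "form \<Rightarrow> form" where
  "all_form \<phi> = neg_form (Exists (neg_form \<phi>))"

definition eq_form :: "nat \<Rightarrow> nat \<Rightarrow> form" where
  "eq_form i j = conj_form (Le i j) (Le j i)"

definition less_form :: "nat \<Rightarrow> nat \<Rightarrow> form" where
  "less_form i j = neg_form (Le j i)"

definition same_colour_form :: "nat \<Rightarrow> nat \<Rightarrow> form" where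
  "same_colour_form i j = conj_form (Col_Le i j) (Col_Le j i)"

lemma wf_connectives [simp]:
  "wf_form k (neg_form \<phi>) \<longleftrightarrow> wf_form k \<phi>"
  "wf_form k (conj_form \<phi> \<psi>) \<longleftrightarrow> wf_form k \<phi> \<and> wf_form k \<psi>"
  "wf_form k (disj_form \<phi> \<psi>) \<longleftrightarrow> wf_form k \<phi> \<and> wf_form k \<psi>"
  "wf_form k (imp_form \<phi> \<psi>) \<longleftrightarrow> wf_form k \<phi> \<and> wf_form k \<psi>"
  "wf_form k (all_form \<phi>) \<longleftrightarrow> wf_form (Suc k) \<phi>"
  "wf_form k (eq_form i j) \<longleftrightarrow> i < k \<and> j < k"
  "wf_form k (less_form i j) \<longleftrightarrow> i < k \<and> j < k"
  "wf_form k (same_colour_form i j) \<longleftrightarrow> i < k \<and> j < k"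
  by (auto simp: neg_form_def conj_form_def disj_form_def imp_form_def all_form_def eq_form_def less_form_def
      same_colour_form_def)

lemma (in coloured_graph) sat_connectives [simp]:
  "sat e (neg_form \<phi>) \<longleftrightarrow> \<not> sat e \<phi>"
  "sat e (conj_form \<phi> \<psi>) \<longleftrightarrow> sat e \<phi> \<and> sat e \<psi>"
  "sat e (disj_form \<phi> \<psi>) \<longleftrightarrow> sat e \<phi> \<or> sat e \<psi>"
  "sat e (imp_form \<phi> \<psi>) \<longleftrightarrow> (sat e \<phi> \<longrightarrow> sat e \<psi>)"
  "sat e (all_form \<phi>) \<longleftrightarrow> (\<forall>v<n. sat (v # e) \<phi>)"
  "sat e (eq_form i j) \<longleftrightarrow> e ! i = e ! j"
  "sat e (less_form i j) \<longleftrightarrow> e ! i < e ! j"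
  "sat e (same_colour_form i j) \<longleftrightarrow> col (e ! i) = col (e ! j)"
  by (auto simp: neg_form_def conj_form_def disj_form_def imp_form_def all_form_def eq_form_def less_form_def
      same_colour_form_def)

text \<open>The arguments are variable indices. Each quantifier puts its variable at index 0, which
  adds one \<open>Suc\<close> to every free index.\<close>

definition component_form :: "nat \<Rightarrow> nat \<Rightarrow> form" where
  "component_form i j =
     disj_form (eq_form i j) (disj_form (Adj i j) (Exists (conj_form (Adj (Suc i) 0) (Adj 0 (Suc j)))))"

definition class_form :: "nat \<Rightarrow> nat \<Rightarrow> form" where
  "class_form i j = conj_form (component_form i j) (same_colour_form j i)"

text \<open>This is the criterion \<open>connected_set_iff\<close> for the colour class, with the
  middle vertex quantified over the class as well.\<close>

definition tidy_form :: "nat \<Rightarrow> form" where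
  "tidy_form i = all_form (all_form (imp_form
     (conj_form (class_form (Suc (Suc i)) (Suc 0)) (class_form (Suc (Suc i)) 0))
     (disj_form (eq_form (Suc 0) 0) (disj_form (Adj (Suc 0) 0)
       (Exists (conj_form (class_form (Suc (Suc (Suc i))) 0)
         (conj_form (Adj (Suc (Suc 0)) 0) (Adj 0 (Suc 0)))))))))"

definition last_candidate_form :: "nat \<Rightarrow> form" where
  "last_candidate_form i =
     disj_form (tidy_form i) (all_form (imp_form (component_form (Suc i) 0) (neg_form (tidy_form 0))))"

definition chosen_form :: "nat \<Rightarrow> form" where
  "chosen_form i = conj_form (last_candidate_form i)
     (all_form (imp_form (conj_form (component_form (Suc i) 0) (less_form 0 (Suc i))) (neg_form (last_candidate_form 0))))"

definition hub_form :: "nat \<Rightarrow> nat \<Rightarrow> form" where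
  "hub_form i j = conj_form (disj_form (eq_form j i) (Adj i j))
     (all_form (imp_form (component_form (Suc i) 0)
       (disj_form (eq_form 0 (Suc i)) (disj_form (eq_form 0 (Suc j))
         (disj_form (Adj (Suc i) 0) (Adj (Suc j) 0))))))"

definition first_hub_form :: "nat \<Rightarrow> nat \<Rightarrow> form" where
  "first_hub_form i j =
     conj_form (hub_form i j) (all_form (imp_form (less_form 0 (Suc j)) (neg_form (hub_form (Suc i) 0))))"

definition core_form :: "nat \<Rightarrow> nat \<Rightarrow> form" where
  "core_form i j = disj_form (eq_form j i) (first_hub_form i j)"

definition hub_colour_form :: "nat \<Rightarrow> nat \<Rightarrow> form" where
  "hub_colour_form i j = Exists (conj_form (first_hub_form (Suc i) 0) (same_colour_form (Suc j) 0))"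

definition first_of_class_form :: "nat \<Rightarrow> form" where
  "first_of_class_form i =
     all_form (imp_form (conj_form (component_form (Suc i) 0) (less_form 0 (Suc i))) (neg_form (same_colour_form 0 (Suc i))))"

lemma wf_forms [simp]:
  "wf_form k (component_form i j) \<longleftrightarrow> i < k \<and> j < k"
  "wf_form k (class_form i j) \<longleftrightarrow> i < k \<and> j < k"
  "wf_form k (tidy_form i) \<longleftrightarrow> i < k"
  "wf_form k (last_candidate_form i) \<longleftrightarrow> i < k"
  "wf_form k (chosen_form i) \<longleftrightarrow> i < k"
  "wf_form k (hub_form i j) \<longleftrightarrow> i < k \<and> j < k"
  "wf_form k (first_hub_form i j) \<longleftrightarrow> i < k \<and> j < k"
  "wf_form k (core_form i j) \<longleftrightarrow> i < k \<and> j < k"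
  "wf_form k (hub_colour_form i j) \<longleftrightarrow> i < k \<and> j < k"
  "wf_form k (first_of_class_form i) \<longleftrightarrow> i < k"
  by (auto simp: component_form_def class_form_def tidy_form_def last_candidate_form_def
      chosen_form_def hub_form_def first_hub_form_def core_form_def hub_colour_form_def
      first_of_class_form_def)

text \<open>The four inner commands mirror the four pieces of \<open>block\<close>. The formula of
  an \<open>Emit\<close> sees the tested vertex at index 0, hence \<open>a\<close> at index 1, or at
  index 2 inside an inner loop; the colour index is counted without that vertex.\<close>

definition paint_cmd :: cmd where
  "paint_cmd = For (When (chosen_form 0)
     (Seq (When (neg_form (tidy_form 0)) (Emit (disj_form (core_form 1 0) (class_form 1 0)) 0))
     (Seq (For (When (conj_form (component_form 1 0) (conj_form (neg_form (same_colour_form 0 1))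
              (conj_form (neg_form (hub_colour_form 1 0)) (first_of_class_form 0))))
            (Emit (disj_form (core_form 2 0) (class_form 1 0)) 0)))
     (Seq (For (When (conj_form (first_hub_form 1 0) (neg_form (same_colour_form 0 1)))
            (Emit (disj_form (core_form 2 0) (class_form 1 0)) 0)))
       (Emit (disj_form (conj_form (tidy_form 1) (class_form 1 0)) (eq_form 0 1)) 0)))))"

lemma wf_paint_cmd: "wf_cmd 0 paint_cmd"
  by (simp add: paint_cmd_def)

lemma concat_map_if: "concat (map (\<lambda>x. if P x then f x else []) xs) = concat (map f (filter P xs))"
  by (induction xs) auto

section \<open>The formulas and the command mean what the plan requires\<close>

locale bounded_painted_cograph =
  painted_cograph G n T + coloured_graph n "adjacent G" T N
  for G :: "nat pair_pre_digraph" and n T N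
begin

lemma sat_component:
  "e ! i < n \<Longrightarrow> e ! j < n \<Longrightarrow> sat e (component_form i j) \<longleftrightarrow> e ! j \<in> component (e ! i)"
  using verts by (auto simp: component_form_def component_def within_two_def)

lemma sat_class:
  "e ! i < n \<Longrightarrow> e ! j < n \<Longrightarrow> sat e (class_form i j) \<longleftrightarrow> e ! j \<in> colour_class (e ! i)"
  by (simp add: class_form_def sat_component colour_class_def)

lemma colour_class_less: "u \<in> colour_class a \<Longrightarrow> u < n"
  using component_less by (auto simp: colour_class_def)

lemma tidy_iff:
  "a < n \<Longrightarrow> tidy a \<longleftrightarrow> (\<forall>u\<in>colour_class a. \<forall>v\<in>colour_class a. within_two G (colour_class a) u v)"
  using component_self[of a] component_subset[of a] verts
  by (auto simp: tidy_def connected_set_iff colour_class_def)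

lemma sat_tidy:
  assumes "e ! i < n"
  shows "sat e (tidy_form i) \<longleftrightarrow> tidy (e ! i)"
proof -
  have "sat e (tidy_form i) \<longleftrightarrow> (\<forall>u<n. \<forall>v<n. u \<in> colour_class (e ! i) \<and> v \<in> colour_class (e ! i) \<longrightarrow>
      u = v \<or> adjacent G u v \<or>
      (\<exists>w<n. w \<in> colour_class (e ! i) \<and> adjacent G u w \<and> adjacent G w v))"
    using assms by (simp add: tidy_form_def sat_class cong: conj_cong)
  also have "\<dots> \<longleftrightarrow> tidy (e ! i)"
    unfolding tidy_iff[OF assms] within_two_def using colour_class_less by blast
  finally show ?thesis .
qed

lemma sat_last_candidate:
  assumes "e ! i < n"
  shows "sat e (last_candidate_form i) \<longleftrightarrow> last_candidate (e ! i)"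
proof -
  have "sat e (last_candidate_form i) \<longleftrightarrow>
      tidy (e ! i) \<or> (\<forall>u<n. u \<in> component (e ! i) \<longrightarrow> \<not> tidy u)"
    using assms by (simp add: last_candidate_form_def sat_tidy sat_component)
  then show ?thesis using component_less by (auto simp: last_candidate_def)
qed

lemma sat_chosen:
  assumes "e ! i < n"
  shows "sat e (chosen_form i) \<longleftrightarrow> chosen (e ! i)"
proof -
  have "sat e (chosen_form i) \<longleftrightarrow> last_candidate (e ! i) \<and>
      (\<forall>u<n. u \<in> component (e ! i) \<and> u < e ! i \<longrightarrow> \<not> last_candidate u)"
    using assms by (simp add: chosen_form_def sat_last_candidate sat_component)
  then show ?thesis using component_less by (auto simp: chosen_def)
qed

lemma sat_hub:
  assumes "e ! i < n" "e ! j < n"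
  shows "sat e (hub_form i j) \<longleftrightarrow> hub (e ! i) (e ! j)"
proof -
  have "sat e (hub_form i j) \<longleftrightarrow> (e ! j = e ! i \<or> adjacent G (e ! i) (e ! j)) \<and>
      (\<forall>w<n. w \<in> component (e ! i) \<longrightarrow>
        w = e ! i \<or> w = e ! j \<or> adjacent G (e ! i) w \<or> adjacent G (e ! j) w)"
    using assms by (simp add: hub_form_def sat_component)
  also have "(\<forall>w<n. w \<in> component (e ! i) \<longrightarrow>
        w = e ! i \<or> w = e ! j \<or> adjacent G (e ! i) w \<or> adjacent G (e ! j) w) \<longleftrightarrow>
      (\<forall>w\<in>component (e ! i). w = e ! i \<or> w = e ! j \<or> adjacent G (e ! i) w \<or> adjacent G (e ! j) w)"
    using component_less by blast
  finally show ?thesis using assms verts by (simp add: hub_def)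
qed

lemma sat_first_hub:
  assumes "e ! i < n" "e ! j < n"
  shows "sat e (first_hub_form i j) \<longleftrightarrow> e ! j = first_hub (e ! i)"
proof -
  have "sat e (first_hub_form i j) \<longleftrightarrow> hub (e ! i) (e ! j) \<and> (\<forall>b<n. b < e ! j \<longrightarrow> \<not> hub (e ! i) b)"
    using assms by (simp add: first_hub_form_def sat_hub)
  also have "\<dots> \<longleftrightarrow> e ! j = first_hub (e ! i)"
  proof
    assume *: "hub (e ! i) (e ! j) \<and> (\<forall>b<n. b < e ! j \<longrightarrow> \<not> hub (e ! i) b)"
    have "first_hub (e ! i) = e ! j"
      unfolding first_hub_def
    proof (rule Least_equality)
      show "hub (e ! i) (e ! j)" using * by simp
      \<comment> \<open>\<open>LEAST\<close> ranges over all numbers and the formula over vertices;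
        below the vertex \<open>e ! j\<close> the two agree.\<close>
      show "e ! j \<le> b" if "hub (e ! i) b" for b
      proof (rule ccontr)
        assume "\<not> e ! j \<le> b"
        then have "b < e ! j" "b < n" using assms(2) by simp_all
        with * that show False by blast
      qed
    qed
    then show "e ! j = first_hub (e ! i)" by (rule sym)
  next
    assume eq: "e ! j = first_hub (e ! i)"
    have "\<not> hub (e ! i) b" if "b < first_hub (e ! i)" for b
      using that unfolding first_hub_def by (rule not_less_Least)
    then show "hub (e ! i) (e ! j) \<and> (\<forall>b<n. b < e ! j \<longrightarrow> \<not> hub (e ! i) b)"
      using hub_first_hub[OF assms(1)] unfolding eq by blast
  qed
  finally show ?thesis .
qed

lemma sat_core:
  "e ! i < n \<Longrightarrow> e ! j < n \<Longrightarrow> sat e (core_form i j) \<longleftrightarrow> e ! j \<in> core (e ! i)"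
  by (simp add: core_form_def sat_first_hub core_def)

lemma first_hub_less: "a < n \<Longrightarrow> first_hub a < n"
  using component_less[OF first_hub_in_component] .

lemma sat_hub_colour:
  assumes "e ! i < n" "e ! j < n"
  shows "sat e (hub_colour_form i j) \<longleftrightarrow> T (e ! j) = T (first_hub (e ! i))"
proof -
  have "sat e (hub_colour_form i j) \<longleftrightarrow> (\<exists>b<n. b = first_hub (e ! i) \<and> T (e ! j) = T b)"
    using assms by (simp add: hub_colour_form_def sat_first_hub cong: conj_cong)
  then show ?thesis using first_hub_less[OF assms(1)] by simp
qed

lemma sat_first_of_class:
  assumes "e ! i < n"
  shows "sat e (first_of_class_form i) \<longleftrightarrow> first_of_class (e ! i)"
proof -
  have "sat e (first_of_class_form i) \<longleftrightarrow>
      (\<forall>u<n. u \<in> component (e ! i) \<and> u < e ! i \<longrightarrow> T u \<noteq> T (e ! i))"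
    using assms by (simp add: first_of_class_form_def sat_component)
  then show ?thesis using component_less by (auto simp: first_of_class_def)
qed

lemmas sat_forms = sat_component sat_class sat_tidy sat_chosen sat_first_hub sat_core
  sat_hub_colour sat_first_of_class

lemma core_class_eq:
  assumes "a < n"
  shows "{v. v < n \<and> (v \<in> core a \<or> v \<in> colour_class w)} = core a \<union> colour_class w"
  using assms first_hub_less colour_class_less by (auto simp: core_def)

lemma emitted_block:
  assumes a: "a < n"
  shows "emitted [a] (Seq (When (neg_form (tidy_form 0)) (Emit (disj_form (core_form 1 0) (class_form 1 0)) 0))
     (Seq (For (When (conj_form (component_form 1 0) (conj_form (neg_form (same_colour_form 0 1))
              (conj_form (neg_form (hub_colour_form 1 0)) (first_of_class_form 0))))
            (Emit (disj_form (core_form 2 0) (class_form 1 0)) 0)))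
     (Seq (For (When (conj_form (first_hub_form 1 0) (neg_form (same_colour_form 0 1)))
            (Emit (disj_form (core_form 2 0) (class_form 1 0)) 0)))
       (Emit (disj_form (conj_form (tidy_form 1) (class_form 1 0)) (eq_form 0 1)) 0)))) = block a"
proof -
  have stroke0: "emitted [a] (When (neg_form (tidy_form 0)) (Emit (disj_form (core_form 1 0) (class_form 1 0)) 0)) =
      (if tidy a then [] else [(core a \<union> colour_class a, T a)])"
    using a core_class_eq[OF a] by (simp add: sat_forms cong: conj_cong)
  have emit: "emitted [w, a] (Emit (disj_form (core_form 2 0) (class_form 1 0)) 0) =
      [(core a \<union> colour_class w, T w)]" if "w < n" for w
    using a that core_class_eq[OF a] by (simp add: sat_forms cong: conj_cong)
  let ?P = "\<lambda>w. w \<in> component a \<and> T w \<noteq> T a \<and> T w \<noteq> T (first_hub a) \<and> first_of_class w"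
  have "emitted [a] (For (When (conj_form (component_form 1 0) (conj_form (neg_form (same_colour_form 0 1))
              (conj_form (neg_form (hub_colour_form 1 0)) (first_of_class_form 0))))
            (Emit (disj_form (core_form 2 0) (class_form 1 0)) 0))) =
      concat (map (\<lambda>w. if ?P w then [(core a \<union> colour_class w, T w)] else []) [0..<n])"
    unfolding emitted.simps(1,2)
    by (rule arg_cong[of _ _ concat], rule map_cong[OF refl])
       (use a in \<open>simp add: emit[unfolded One_nat_def] sat_forms first_hub_less del: emitted.simps\<close>)
  also have "\<dots> = map (\<lambda>w. (core a \<union> colour_class w, T w)) (filter ?P [0..<n])"
    unfolding concat_map_if by (simp add: concat_map_singleton)
  finally have stroke1: "emitted [a] (For (When (conj_form (component_form 1 0) (conj_form (neg_form (same_colour_form 0 1))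
              (conj_form (neg_form (hub_colour_form 1 0)) (first_of_class_form 0))))
            (Emit (disj_form (core_form 2 0) (class_form 1 0)) 0))) =
      map (\<lambda>w. (core a \<union> colour_class w, T w)) (filter ?P [0..<n])" .
  \<comment> \<open>This loop acts as a binding for the hub: exactly one vertex can pass the
    test.\<close>
  let ?Q = "\<lambda>w. w = first_hub a \<and> T w \<noteq> T a"
  have "emitted [a] (For (When (conj_form (first_hub_form 1 0) (neg_form (same_colour_form 0 1)))
            (Emit (disj_form (core_form 2 0) (class_form 1 0)) 0))) =
      concat (map (\<lambda>w. if ?Q w then [(core a \<union> colour_class w, T w)] else []) [0..<n])"
    unfolding emitted.simps(1,2)
    by (rule arg_cong[of _ _ concat], rule map_cong[OF refl])
       (use a in \<open>auto simp: emit[unfolded One_nat_def] sat_forms first_hub_less simp del: emitted.simps\<close>)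
  also have "\<dots> = map (\<lambda>w. (core a \<union> colour_class w, T w)) (filter ?Q [0..<n])"
    unfolding concat_map_if by (simp add: concat_map_singleton)
  also have "filter ?Q [0..<n] = (if T (first_hub a) = T a then [] else [first_hub a])"
  proof -
    have "filter (\<lambda>w. w = h \<and> R w) [0..<m] = (if h < m \<and> R h then [h] else [])" for h m R
      by (induction m) (auto simp: less_Suc_eq)
    then show ?thesis using first_hub_less[OF a] by auto
  qed
  finally have stroke2: "emitted [a] (For (When (conj_form (first_hub_form 1 0) (neg_form (same_colour_form 0 1)))
            (Emit (disj_form (core_form 2 0) (class_form 1 0)) 0))) =
      (if T (first_hub a) = T a then []
       else [(core a \<union> colour_class (first_hub a), T (first_hub a))])" by simp
  \<comment> \<open>One formula covers both forms of the last stroke, as \<open>a\<close> belongs to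
    its own colour class.\<close>
  have "{v. v < n \<and> (tidy a \<and> v \<in> colour_class a \<or> v = a)} = (if tidy a then colour_class a else {a})"
    using a component_self[of a] verts colour_class_less by (auto simp: colour_class_def)
  then have stroke3: "emitted [a] (Emit (disj_form (conj_form (tidy_form 1) (class_form 1 0)) (eq_form 0 1)) 0) =
      [(if tidy a then colour_class a else {a}, T a)]"
    using a by (simp add: sat_forms cong: conj_cong)
  show ?thesis
    unfolding emitted.simps(3) stroke0 stroke1 stroke2 stroke3 block_def by simp
qed

lemma emitted_plan: "emitted [] paint_cmd = plan"
proof -
  have "emitted [] paint_cmd = concat (map (\<lambda>a. if chosen a then block a else []) [0..<n])"
    unfolding paint_cmd_def emitted.simps(1,2)
    by (rule arg_cong[of _ _ concat], rule map_cong[OF refl])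
       (simp only: emitted_block sat_chosen nth_Cons_0 set_upt atLeastLessThan_iff)
  then show ?thesis by (simp add: concat_map_if plan_def)
qed

end

theorem theorem8:
  shows "\<exists>(P :: program) (q :: nat poly).
    \<forall>(G :: nat pair_pre_digraph) (n :: nat) (k :: nat) (t :: (nat, nat) painting).
      cograph G \<and> n \<ge> 1 \<and> pverts G = {..<n} \<and> is_template G {..<k} t \<longrightarrow>
      (\<exists>ss time. computes P (enc_input G k t) (enc_plan G ss) time \<and>
                 optimal_paint_plan G {..<k} t ss \<and>
                 time \<le> poly q (graph_size G + k))"
proof -
  obtain q where q: "\<And>n adj col N k. coloured_graph n col N \<Longrightarrow>
    \<exists>time \<le> poly q N. computes (interpreter paint_cmd)
       (Bin (coloured_graph.matrix n adj) (Bin k (coloured_graph.colours n col)))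
       (enc_list (coloured_graph.enc_vertex_set_stroke n)
         (coloured_graph.emitted n adj col [] paint_cmd)) time"
    using interpreter_computes[OF wf_paint_cmd] by blast
  have "\<exists>ss time. computes (interpreter paint_cmd) (enc_input G k t) (enc_plan G ss) time \<and>
      optimal_paint_plan G {..<k} t ss \<and> time \<le> poly q (graph_size G + k)"
    if G: "cograph G" and n: "n \<ge> 1" and V: "pverts G = {..<n}" and t: "is_template G {..<k} t"
    for G :: "nat pair_pre_digraph" and n k :: nat and t
  proof -
    \<comment> \<open>Off the vertices the value of \<open>T\<close> is unspecified;
      \<open>t_eq\<close> masks it there.\<close>
    define T where "T v = the (t v)" for v
    have dom: "dom t = {..<n}" and ran: "ran t \<subseteq> {..<k}"
      using t V by (auto simp: is_template_def is_painting_def)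
    have t_eq: "t v = (if v < n then Some (T v) else None)" for v
      using dom by (auto simp: T_def domIff set_eq_iff)
    then have T: "T v < k" if "v < n" for v
      using that ran by (metis lessThan_iff ranI subsetD)
    have card: "card (pverts G) = n" using V by simp
    \<comment> \<open>The bound \<open>N\<close> becomes \<open>graph_size G + k\<close>: the graph
      size covers the vertices, and \<open>k\<close> the colours.\<close>
    interpret bounded_painted_cograph G n T "graph_size G + k"
    proof
      show "n \<le> graph_size G + k" using card by (simp add: graph_size_def)
      show "T v \<le> graph_size G + k" if "v < n" for v using T[OF that] by simp
    qed (use G V in auto)
    have input: "enc_input G k t = Bin matrix (Bin (enc_nat k) colours)"
      by (simp add: enc_input_def enc_graph_def enc_template_def matrix_def colours_def card Let_def
          flip: T_def)
    have "enc_stroke G = enc_vertex_set_stroke"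
      by (simp add: fun_eq_iff enc_stroke_def enc_vertex_set_stroke_def card)
    then have result: "enc_plan G plan = enc_strokes (emitted [] paint_cmd)"
      by (simp add: enc_plan_def emitted_plan)
    obtain time where "time \<le> poly q (graph_size G + k)"
      "computes (interpreter paint_cmd) (enc_input G k t) (enc_plan G plan) time"
      using q[OF coloured_graph_axioms, of "adjacent G" "enc_nat k"] unfolding input result by blast
    moreover have "optimal_paint_plan G {..<k} t plan"
      using n T by (intro optimal_plan t_eq) auto
    ultimately show ?thesis by blast
  qed
  then show ?thesis by blast
qed

end
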